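(* Suppose that $0<p\le1$ and $\beta>0$. There exist positive constants $C'$ (depending only on $n$, $p$ and $\beta$) and $c_\beta$ (depending only on $\beta$), with $0<c_\beta<1$, such that the following holds. If $U\in\mathcal{T}^p(\mathbb{R}^n\times\mathbb{R}^+)$ and $\operatorname{supp}U\subset T_\beta(\Omega)$ for some nonempty proper open subset $\Omega$ of $\mathbb{R}^n$, then there exist a sequence $(\lambda_k)_{k\in\mathbb{N}}$ in $\ell^p(\mathbb{C})$ and a sequence $(A_k)_{k\in\mathbb{N}}$ of $\mathcal{T}^p(\mathbb{R}^n\times\mathbb{R}^+)$-atoms, supported in corresponding tents $(T(B_k))_{k\in\mathbb{N}}$ over balls $B_k$, such that (i) $U=\sum_{k\in\mathbb{N}}\lambda_kA_k$ in $\mathcal{T}^p(\mathbb{R}^n\times\mathbb{R}^+)$; (ii) $\sum_{k\in\mathbb{N}}|\lambda_k|^p\le C'\,\|U\|^p_{\mathcal{T}^p(\mathbb{R}^n\times\mathbb{R}^+)}$; (iii) $\operatorname{supp}A_k\subset c_\beta B_k\times(0,6\beta^{-1}c_\beta\,r(B_k))$ and $5c_\beta B_k\subset\Omega$ for all $k\in\mathbb{N}$.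
   Context: $\mathbb{R}^+=(0,\infty)$. For a ball $B\subset\mathbb{R}^n$, $r(B)$ is its radius, $|B|$ its volume, and $cB$ is the ball with the same centre and radius $c\,r(B)$. For $x\in\mathbb{R}^n$ let $\Gamma'(x)=\{(y,t)\in\mathbb{R}^n\times\mathbb{R}^+:|y-x|<t\}$. For a measurable (complex valued) function $U$ on $\mathbb{R}^n\times\mathbb{R}^+$ put $$(SU)(x)=\Big(\iint_{\Gamma'(x)}|U(y,t)|^2\,\frac{dy\,dt}{t^{n+1}}\Big)^{1/2}.$$ The tent space $\mathcal{T}^p(\mathbb{R}^n\times\mathbb{R}^+)$ is the set of all measurable $U$ with $\|U\|_{\mathcal{T}^p(\mathbb{R}^n\times\mathbb{R}^+)}:=\|SU\|_{L^p(\mathbb{R}^n)}<\infty$. For an open set $O\subset\mathbb{R}^n$ and $\beta>0$, the tent over $O$ with aperture $\beta$ is $T_\beta(O)=\{(y,t)\in\mathbb{R}^n\times\mathbb{R}^+:d(y,O^c)\ge\beta t\}$, where $d$ is Euclidean distance and $O^c=\mathbb{R}^n\setminus O$; $T(O)=T_1(O)$. A measurable function $A$ on $\mathbb{R}^n\times\mathbb{R}^+$ is a $\mathcal{T}^p(\mathbb{R}^n\times\mathbb{R}^+)$-atom (supported in the tent $T(B)$) if there is a ball $B$ in $\mathbb{R}^n$ such that $\operatorname{supp}A\subset T(B)$ and $\iint_{\mathbb{R}^n\times\mathbb{R}^+}|A(y,t)|^2\,dy\,\frac{dt}{t}\le|B|^{1-2/p}$. For a measurable function $F$ on $\mathbb{R}^n\times\mathbb{R}^+$,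 "$\operatorname{supp}F\subset E$" means that $F=0$ almost everywhere outside $E$. *)

theory Defs
  imports "HOL-Analysis.Analysis"
begin

text \<open>
  The dimension \<open>n\<close> is a natural number rather than a type index, because the statement needs
  a constant that is independent of \<open>n\<close>, so \<open>n\<close> must be quantified inside the formula.
  Points of \<open>n\<close>-dimensional space are the functions that are extensional on \<open>{..<n}\<close>, i.e. the
  points of the product measure space \<open>\<Pi>\<^sub>M i\<in>{..<n}. lborel\<close>.
\<close>

type_synonym point = "nat \<Rightarrow> real"

definition Rn :: "nat \<Rightarrow> point set" where
  "Rn n = {..<n} \<rightarrow>\<^sub>E UNIV"

definition edist :: "nat \<Rightarrow> point \<Rightarrow> point \<Rightarrow> real" where
  "edist n x y = L2_set (\<lambda>i. x i - y i) {..<n}"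

lemma Metric_space_Rn: "Metric_space (Rn n) (edist n)"
proof
  show "0 \<le> edist n x y" for x y
    by (simp add: edist_def)
  show "edist n x y = edist n y x" for x y
    by (simp add: edist_def L2_set_def power2_commute)
  show "edist n x y = 0 \<longleftrightarrow> x = y" if "x \<in> Rn n" "y \<in> Rn n" for x y
    using that by (auto simp: edist_def L2_set_eq_0_iff Rn_def intro: PiE_ext)
  show "edist n x z \<le> edist n x y + edist n y z" for x y z
    using L2_set_triangle_ineq[of "\<lambda>i. x i - y i" "\<lambda>i. y i - z i" "{..<n}"]
    by (simp add: edist_def)
qed

abbreviation nball :: "nat \<Rightarrow> point \<Rightarrow> real \<Rightarrow> point set" where
  "nball n \<equiv> Metric_space.mball (Rn n) (edist n)"

abbreviation nopen :: "nat \<Rightarrow> point set \<Rightarrow> bool" where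
  "nopen n \<equiv> openin (Metric_space.mtopology (Rn n) (edist n))"

text \<open>Completed measures, so that measurability is Lebesgue measurability.\<close>

definition leb_Rn :: "nat \<Rightarrow> point measure" where
  "leb_Rn n = completion (\<Pi>\<^sub>M i\<in>{..<n}. lborel)"

definition leb_half :: "nat \<Rightarrow> (point \<times> real) measure" where
  "leb_half n = completion ((\<Pi>\<^sub>M i\<in>{..<n}. lborel) \<Otimes>\<^sub>M restrict_space lborel {0<..})"

lemma space_leb_Rn: "space (leb_Rn n) = Rn n"
  by (simp add: leb_Rn_def Rn_def space_PiM)

lemma space_leb_half: "space (leb_half n) = Rn n \<times> {0<..}"
  by (simp add: leb_half_def Rn_def space_PiM space_pair_measure space_restrict_space)

text \<open>Real powers on \<open>[0,\<infinity>]\<close>; only used with exponents \<open>a > 0\<close>.\<close>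

definition epowr :: "ennreal \<Rightarrow> real \<Rightarrow> ennreal" where
  "epowr u a = (if u = \<infinity> then \<infinity> else ennreal (enn2real u powr a))"

definition tcone :: "nat \<Rightarrow> point \<Rightarrow> (point \<times> real) set" where
  "tcone n x = {(y, t). y \<in> Rn n \<and> 0 < t \<and> edist n y x < t}"

definition area_fun :: "nat \<Rightarrow> (point \<times> real \<Rightarrow> complex) \<Rightarrow> point \<Rightarrow> ennreal" where
  "area_fun n U x =
     epowr (\<integral>\<^sup>+z\<in>tcone n x. ennreal ((cmod (U z))\<^sup>2 / snd z ^ (n + 1)) \<partial>leb_half n) (1/2)"

definition tent_norm :: "nat \<Rightarrow> real \<Rightarrow> (point \<times> real \<Rightarrow> complex) \<Rightarrow> ennreal" where
  "tent_norm n p U = epowr (\<integral>\<^sup>+x. epowr (area_fun n U x) p \<partial>leb_Rn n) (1/p)"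

definition tent_space :: "nat \<Rightarrow> real \<Rightarrow> (point \<times> real \<Rightarrow> complex) set" where
  "tent_space n p = {U \<in> borel_measurable (leb_half n). tent_norm n p U < \<infinity>}"

text \<open>The infimum defining the distance to the complement is taken in the extended reals, so
  the distance to the empty set is \<open>\<infinity>\<close>.\<close>

definition tent :: "nat \<Rightarrow> real \<Rightarrow> point set \<Rightarrow> (point \<times> real) set" where
  "tent n \<beta> Q = {(y, t). y \<in> Rn n \<and> 0 < t \<and>
     (INF z\<in>Rn n - Q. ereal (edist n y z)) \<ge> ereal (\<beta> * t)}"

definition supp_in :: "nat \<Rightarrow> (point \<times> real \<Rightarrow> complex) \<Rightarrow> (point \<times> real) set \<Rightarrow> bool" where
  "supp_in n F E \<longleftrightarrow> (AE z in leb_half n. z \<notin> E \<longrightarrow> F z = 0)"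

text \<open>\<open>tent_atom n p x r A\<close>: \<open>A\<close> is an atom supported in the tent over the ball with centre \<open>x\<close>
  and radius \<open>r\<close>.\<close>

definition tent_atom ::
    "nat \<Rightarrow> real \<Rightarrow> point \<Rightarrow> real \<Rightarrow> (point \<times> real \<Rightarrow> complex) \<Rightarrow> bool" where
  "tent_atom n p x r A \<longleftrightarrow>
     x \<in> Rn n \<and> 0 < r \<and> A \<in> borel_measurable (leb_half n) \<and>
     supp_in n A (tent n 1 (nball n x r)) \<and>
     (\<integral>\<^sup>+z. ennreal ((cmod (A z))\<^sup>2 / snd z) \<partial>leb_half n)
       \<le> ennreal (measure (leb_Rn n) (nball n x r) powr (1 - 2/p))"

end

theory Submission
  imports Defs
begin

text \<open>
  The square function controls the energy of \<open>U\<close> one Whitney box at a time, and this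
  makes a purely dyadic stopping time argument possible, without maximal functions or a Whitney
  decomposition of the level sets.

  Cut the half space into boxes: the box of a dyadic cube \<open>Q\<close> of side \<open>h\<close> lies over \<open>Q\<close> at the
  heights \<open>\<kappa> h / 2 < t \<le> \<kappa> h\<close>, where \<open>\<kappa>\<close> depends on \<open>n\<close> and \<open>\<beta>\<close> only and is so large that the box of
  \<open>Q\<close> is contained in the cone over each point of \<open>Q\<close>.  For any family of cubes containing \<open>x\<close> the
  integrals of \<open>\<bar>U\<bar>\<^sup>2 / t ^ (n + 1)\<close> over their boxes therefore add up to at most \<open>(SU)(x)\<^sup>2\<close>
  (\<open>sum_flux_le\<close>).

  Call \<open>Q\<close> heavy for \<open>k\<close> if \<open>SU > 2 powr k\<close> on more than half of \<open>Q\<close>.  A cube whose box carries some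
  mass of \<open>U\<close> is heavy for very negative \<open>k\<close>, and for large \<open>k\<close> it is not, because \<open>SU\<close> is in \<open>L\<^sup>p\<close>; let
  \<open>k\<close> be the level with \<open>Q\<close> heavy for \<open>k\<close> and not for \<open>k + 1\<close>, and let \<open>R\<close> be the largest dyadic cube
  containing \<open>Q\<close> that is heavy for \<open>k\<close> and far enough from the complement of \<open>\<Omega>\<close>.  The boxes with a
  common pair \<open>(k, R)\<close> carry one atom.  Two estimates suffice.  Each \<open>Q\<close> of the pair has at least half
  of its volume where \<open>SU \<le> 2 powr (k + 1)\<close>, so integrating the bound above over that part of \<open>R\<close>
  gives energy at most \<open>C * 4 powr k * \<bar>R\<bar>\<close> (\<open>energy_sum_le\<close>), which fixes the coefficient as a multiple
  of \<open>2 powr k * \<bar>R\<bar> powr (1 / p)\<close>.  For fixed \<open>k\<close> the maximal cubes \<open>R\<close> are disjoint and each has more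
  than half of its volume in \<open>{SU > 2 powr k}\<close>, so the \<open>p\<close>-th powers of the coefficients add up to a
  multiple of \<open>\<Sum>k. 2 powr (k * p) * \<bar>{SU > 2 powr k}\<bar>\<close>, hence of the integral of \<open>(SU) powr p\<close>
  (\<open>sum_maximal_le\<close>).

  The pieces have disjoint supports, so the remainders of the series decrease to zero almost
  everywhere in modulus, and dominated convergence, first in the cones and then for \<open>(SU) powr p\<close>,
  gives convergence of the series (\<open>tent_norm_remainder_tendsto\<close>).

  The inner ball of an atom is centred in the corner of \<open>R\<close> and has radius
  \<open>\<rho> = min (d / 5) (K * side R)\<close>, with \<open>d\<close> the distance of the corner from the complement of \<open>\<Omega>\<close>.
  Then the ball of radius \<open>5 \<rho>\<close> is in \<open>\<Omega>\<close> and the volumes of the ball and of \<open>R\<close> are comparable.  If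
  \<open>\<rho> = K * side R\<close>, the boxes below \<open>R\<close> are lower than \<open>6 \<rho> / \<beta>\<close> by the choice of \<open>K\<close>; if \<open>\<rho> = d / 5\<close>,
  points \<open>(y, t)\<close> of the tent over the inner ball satisfy \<open>\<beta> t \<le> \<rho> + d = 6 \<rho>\<close>
  (\<open>height_less\<close>).
\<close>

section \<open>Powers of extended nonnegative numbers\<close>

lemma epowr_eq_top_iff: "epowr u a = top \<longleftrightarrow> u = top"
  by (simp add: epowr_def)

lemma epowr_ennreal: "0 \<le> x \<Longrightarrow> epowr (ennreal x) a = ennreal (x powr a)"
  by (simp add: epowr_def)

lemma epowr_0 [simp]: "epowr 0 a = 0"
  by (simp add: epowr_def)

lemma epowr_epowr: "epowr (epowr u a) b = epowr u (a * b)"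
  by (simp add: epowr_def powr_powr)

lemma epowr_1 [simp]: "epowr u 1 = u"
  by (cases u) (auto simp: epowr_def)

lemma epowr_mono:
  assumes "u \<le> v" "0 \<le> a"
  shows "epowr u a \<le> epowr v a"
proof (cases "v = top")
  case False
  with assms have "u \<noteq> top" by (auto simp: top_unique)
  with False assms show ?thesis
    by (cases u; cases v) (auto simp: epowr_def intro!: ennreal_leI powr_mono2)
qed (simp add: epowr_def)

lemma measurable_epowr [measurable]: "(\<lambda>u. epowr u a) \<in> borel_measurable borel"
  unfolding epowr_def by measurable

lemma tendsto_epowr_zero:
  assumes f: "(f \<longlongrightarrow> 0) F" and a: "0 < a"
  shows "((\<lambda>x. epowr (f x) a) \<longlongrightarrow> 0) F"
proof -
  have fin: "\<forall>\<^sub>F x in F. f x < top"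
    using f by (rule order_tendstoD) simp
  have "((\<lambda>x. enn2real (f x)) \<longlongrightarrow> 0) F"
    using tendsto_enn2real[of f 0 F] f by simp
  then have "((\<lambda>x. enn2real (f x) powr a) \<longlongrightarrow> 0 powr a) F"
    using a by (intro tendsto_powr2) (auto simp: eventually_at_filter)
  then have "((\<lambda>x. ennreal (enn2real (f x) powr a)) \<longlongrightarrow> ennreal 0) F"
    by (intro tendsto_ennrealI) simp
  moreover have "\<forall>\<^sub>F x in F. ennreal (enn2real (f x) powr a) = epowr (f x) a"
    using fin by eventually_elim (simp add: epowr_def)
  ultimately show ?thesis
    by (simp add: tendsto_cong)
qed

section \<open>Lebesgue measure\<close>

abbreviation leb_base :: "nat \<Rightarrow> point measure" where
  "leb_base n \<equiv> \<Pi>\<^sub>M i\<in>{..<n}. lborel"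

abbreviation half_base :: "nat \<Rightarrow> (point \<times> real) measure" where
  "half_base n \<equiv> leb_base n \<Otimes>\<^sub>M restrict_space lborel {0<..}"

lemma sigma_finite_half_base: "sigma_finite_measure (half_base n)"
proof -
  interpret P: product_sigma_finite "\<lambda>_::nat. lborel :: real measure" ..
  interpret P: finite_product_sigma_finite "\<lambda>_::nat. lborel :: real measure" "{..<n}"
    by standard simp
  interpret L: sigma_finite_measure "restrict_space lborel {0<..} :: real measure"
    by (rule sigma_finite_measure_restrict_space) (auto intro: sigma_finite_lborel)
  interpret pair_sigma_finite "leb_base n" "restrict_space lborel {0<..} :: real measure" ..
  show ?thesis ..
qed

lemma measurable_snd_half [measurable]: "snd \<in> borel_measurable (half_base n)"
proof -
  have "(\<lambda>x. x) \<in> borel_measurable (restrict_space lborel {0<..} :: real measure)"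
    by (rule measurable_restrict_space1) simp
  then show ?thesis by (rule measurable_compose[OF measurable_snd])
qed

lemma measurable_coord_half [measurable]:
  "i < n \<Longrightarrow> (\<lambda>z. fst z i) \<in> borel_measurable (half_base n)"
  by simp

lemma measurable_edist [measurable (raw)]:
  assumes "\<And>i. i < n \<Longrightarrow> (\<lambda>z. f z i) \<in> borel_measurable M"
    and "\<And>i. i < n \<Longrightarrow> (\<lambda>z. g z i) \<in> borel_measurable M"
  shows "(\<lambda>z. edist n (f z) (g z)) \<in> borel_measurable M"
  unfolding edist_def L2_set_def using assms by measurable

lemma tcone_eq: "tcone n x = {z \<in> space (half_base n). edist n (fst z) x < snd z}"
  using L2_set_nonneg by (fastforce simp: tcone_def space_pair_measure space_PiM Rn_def
      space_restrict_space edist_def intro: le_less_trans)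

text \<open>
  The square of the area function.  All level sets and estimates are stated for it, so that
  square roots never occur.
\<close>

definition sq_area :: "nat \<Rightarrow> (point \<times> real \<Rightarrow> complex) \<Rightarrow> point \<Rightarrow> ennreal" where
  "sq_area n U x = (\<integral>\<^sup>+z\<in>tcone n x. ennreal ((cmod (U z))\<^sup>2 / snd z ^ (n + 1)) \<partial>leb_half n)"

lemma epowr_area_fun: "epowr (area_fun n U x) p = epowr (sq_area n U x) (p / 2)"
  by (simp add: area_fun_def sq_area_def epowr_epowr)

lemma tent_norm_eq: "tent_norm n p U = epowr (\<integral>\<^sup>+x. epowr (sq_area n U x) (p / 2) \<partial>leb_Rn n) (1 / p)"
  by (simp add: tent_norm_def epowr_area_fun)

lemma tcone_sets: "tcone n x \<in> sets (half_base n)"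
  unfolding tcone_eq by measurable

lemma measurable_leb_half: "f \<in> borel_measurable (half_base n) \<Longrightarrow> f \<in> borel_measurable (leb_half n)"
  unfolding leb_half_def by (rule measurable_completion)

lemma sets_leb_half: "A \<in> sets (half_base n) \<Longrightarrow> A \<in> sets (leb_half n)"
  unfolding leb_half_def by simp

lemma sets_leb_Rn: "A \<in> sets (leb_base n) \<Longrightarrow> A \<in> sets (leb_Rn n)"
  unfolding leb_Rn_def by simp

lemma measurable_weight [measurable]:
  fixes U :: "point \<times> real \<Rightarrow> complex"
  assumes "U \<in> borel_measurable (leb_half n)"
  shows "(\<lambda>z. ennreal ((cmod (U z))\<^sup>2 / snd z ^ k)) \<in> borel_measurable (leb_half n)"
proof -
  note [measurable] = assms measurable_leb_half[OF measurable_snd_half]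
  show ?thesis by measurable
qed

text \<open>Fubini's theorem gives the measurability for a Borel integrand.  The general integrand is
  measurable only for the completed measure and is replaced by an almost everywhere equal Borel
  one, which changes no value of the area function.\<close>

lemma measurable_sq_area [measurable]:
  assumes U: "U \<in> borel_measurable (leb_half n)"
  shows "sq_area n U \<in> borel_measurable (leb_Rn n)"
proof -
  interpret sigma_finite_measure "half_base n" by (rule sigma_finite_half_base)
  obtain g where g [measurable]: "g \<in> borel_measurable (half_base n)"
    and ae: "AE z in half_base n. ennreal ((cmod (U z))\<^sup>2 / snd z ^ (n + 1)) = g z"
    using completion_ex_borel_measurable[OF measurable_weight[OF U, of "n + 1", unfolded leb_half_def]]
    by blast
  have eq: "sq_area n U x = (\<integral>\<^sup>+z. g z * indicator {z. edist n (fst z) x < snd z} z \<partial>half_base n)"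
    for x
    unfolding sq_area_def leb_half_def nn_integral_completion
    using ae by (intro nn_integral_cong_AE) (auto simp: tcone_eq indicator_def elim!: eventually_mono)
  have [measurable]: "(\<lambda>w. snd (snd w)) \<in> borel_measurable (leb_base n \<Otimes>\<^sub>M half_base n)"
    using measurable_compose[OF measurable_snd measurable_snd_half] .
  have [measurable]: "(\<lambda>w. fst (snd w) i) \<in> borel_measurable (leb_base n \<Otimes>\<^sub>M half_base n)" if "i < n" for i
    using measurable_compose[OF measurable_snd measurable_coord_half[OF that]] .
  have [measurable]: "(\<lambda>w. fst w i) \<in> borel_measurable (leb_base n \<Otimes>\<^sub>M half_base n)" if "i < n" for i
    using that by simp
  have [measurable]: "(\<lambda>w. edist n (fst (snd w)) (fst w)) \<in> borel_measurable (leb_base n \<Otimes>\<^sub>M half_base n)"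
    by (rule measurable_edist) simp_all
  have "(\<lambda>(x, z). g z * indicator {z. edist n (fst z) x < snd z} z)
      = (\<lambda>w. g (snd w) * (if edist n (fst (snd w)) (fst w) < snd (snd w) then 1 else 0))"
    by (auto simp: fun_eq_iff)
  also have "\<dots> \<in> borel_measurable (leb_base n \<Otimes>\<^sub>M half_base n)"
    by measurable
  finally have "(\<lambda>x. \<integral>\<^sup>+z. g z * indicator {z. edist n (fst z) x < snd z} z \<partial>half_base n)
      \<in> borel_measurable (leb_base n)"
    by (rule borel_measurable_nn_integral)
  then show ?thesis
    unfolding leb_Rn_def eq[abs_def] by (rule measurable_completion)
qed

lemma sq_area_mono:
  assumes "\<And>z. cmod (V z) \<le> cmod (U z)"
  shows "sq_area n V x \<le> sq_area n U x"
  unfolding sq_area_def leb_half_def nn_integral_completion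
  by (rule nn_integral_mono)
     (auto intro!: mult_right_mono ennreal_leI divide_right_mono power_mono assms
       simp: tcone_eq space_pair_measure space_restrict_space split: split_indicator)

section \<open>Balls and dyadic cubes\<close>

lemma mem_nball: "y \<in> nball n x r \<longleftrightarrow> x \<in> Rn n \<and> y \<in> Rn n \<and> edist n x y < r"
  by (simp add: Metric_space.in_mball[OF Metric_space_Rn])

lemma edist_commute: "edist n x y = edist n y x"
  by (simp add: Metric_space.commute[OF Metric_space_Rn])

lemma edist_nonneg: "0 \<le> edist n x y"
  by (simp add: Metric_space.nonneg[OF Metric_space_Rn])

lemma edist_triangle: "edist n x z \<le> edist n x y + edist n y z"
  using L2_set_triangle_ineq[of "\<lambda>i. x i - y i" "\<lambda>i. y i - z i" "{..<n}"]
  by (simp add: edist_def)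

lemma coord_le_edist:
  assumes "i < n"
  shows "\<bar>x i - y i\<bar> \<le> edist n x y"
proof -
  have "(x i - y i)\<^sup>2 \<le> (\<Sum>i<n. (x i - y i)\<^sup>2)"
    using assms by (intro member_le_sum) auto
  then show ?thesis
    unfolding edist_def L2_set_def by (rule real_le_rsqrt[of "\<bar>x i - y i\<bar>", simplified])
qed

lemma edist_less:
  assumes "0 < n" "\<And>i. i < n \<Longrightarrow> \<bar>x i - y i\<bar> < h"
  shows "edist n x y < n * h"
proof -
  have "edist n x y \<le> (\<Sum>i<n. \<bar>x i - y i\<bar>)"
    unfolding edist_def by (rule L2_set_le_sum_abs)
  also have "\<dots> < (\<Sum>i<n. h)"
    using assms by (intro sum_strict_mono) auto
  finally show ?thesis by simp
qed

lemma space_leb_base: "space (leb_base n) = Rn n"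
  by (simp add: space_PiM Rn_def)

lemma nball_sets: "nball n x r \<in> sets (leb_base n)"
proof (cases "x \<in> Rn n")
  case True
  have [measurable]: "(\<lambda>y. edist n x y) \<in> borel_measurable (leb_base n)"
    by (rule measurable_edist) simp_all
  have "nball n x r = {y \<in> space (leb_base n). edist n x y < r}"
    using True by (auto simp: mem_nball space_leb_base)
  then show ?thesis by simp
next
  case False
  then have "nball n x r = {}" by (auto simp: mem_nball)
  then show ?thesis by simp
qed

lemma emeasure_box:
  assumes "\<And>i. i < n \<Longrightarrow> a i \<le> b i"
  shows "emeasure (leb_base n) (\<Pi>\<^sub>E i\<in>{..<n}. {a i..<b i}) = ennreal (\<Prod>i<n. b i - a i)"
proof -
  interpret P: product_sigma_finite "\<lambda>_::nat. lborel :: real measure" ..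
  have "emeasure (leb_base n) (\<Pi>\<^sub>E i\<in>{..<n}. {a i..<b i}) = (\<Prod>i<n. emeasure lborel {a i..<b i})"
    by (rule P.emeasure_PiM) auto
  also have "\<dots> = (\<Prod>i<n. ennreal (b i - a i))"
    using assms by (intro prod.cong) auto
  also have "\<dots> = ennreal (\<Prod>i<n. b i - a i)"
    using assms by (intro prod_ennreal) auto
  finally show ?thesis .
qed

lemma emeasure_nball_le:
  assumes "0 \<le> r"
  shows "emeasure (leb_Rn n) (nball n x r) \<le> ennreal ((2 * r) ^ n)"
proof -
  let ?B = "\<Pi>\<^sub>E i\<in>{..<n}. {x i - r..<x i + r}"
  have "nball n x r \<subseteq> ?B"
  proof
    fix y assume y: "y \<in> nball n x r"
    have "y i \<in> {x i - r..<x i + r}" if "i < n" for i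
      using coord_le_edist[OF that, of x y] y by (auto simp: mem_nball abs_le_iff)
    then show "y \<in> ?B"
      using y unfolding mem_nball by (auto simp: Rn_def PiE_iff)
  qed
  then have "emeasure (leb_base n) (nball n x r) \<le> emeasure (leb_base n) ?B"
    by (rule emeasure_mono) (auto intro!: sets_PiM_I_finite)
  also have "\<dots> = ennreal ((2 * r) ^ n)"
    using assms by (subst emeasure_box) auto
  finally show ?thesis
    by (simp add: leb_Rn_def nball_sets)
qed

text \<open>A dyadic cube is coded by the exponent \<open>j\<close> of its side \<open>2 powr j\<close> and by the integer
  coordinates of its corner in units of the side.  The code ranges over a countable type, so sums
  over cubes are integrals for a counting measure.\<close>

type_synonym cube = "int \<times> int list"

text \<open>
  Membership in a half-open dyadic cube is an equation between lists of integer parts, which makes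
  the partition and nesting properties of the cubes statements about \<open>floor\<close>.
\<close>

definition key :: "nat \<Rightarrow> int \<Rightarrow> point \<Rightarrow> int list" where
  "key n j x = map (\<lambda>i. \<lfloor>x i / 2 powr j\<rfloor>) [0..<n]"

definition dcube :: "nat \<Rightarrow> cube \<Rightarrow> point set" where
  "dcube n Q = {x \<in> Rn n. key n (fst Q) x = snd Q}"

definition side :: "cube \<Rightarrow> real" where
  "side Q = 2 powr real_of_int (fst Q)"

definition corner :: "nat \<Rightarrow> cube \<Rightarrow> point" where
  "corner n Q = (\<lambda>i\<in>{..<n}. real_of_int (snd Q ! i) * side Q)"

lemma side_pos [simp]: "0 < side Q"
  by (simp add: side_def)

lemma key_eq_iff:
  "key n j x = m \<longleftrightarrow> length m = n \<and> (\<forall>i<n. \<lfloor>x i / 2 powr j\<rfloor> = m ! i)"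
  by (auto simp: key_def list_eq_iff_nth_eq)

lemma length_cube: "x \<in> dcube n Q \<Longrightarrow> length (snd Q) = n"
  by (auto simp: dcube_def key_def dest!: arg_cong[where f=length])

lemma dcube_eq_box:
  assumes "length (snd Q) = n"
  shows "dcube n Q = (\<Pi>\<^sub>E i\<in>{..<n}. {real_of_int (snd Q ! i) * side Q..<real_of_int (snd Q ! i + 1) * side Q})"
proof -
  have "\<lfloor>t / 2 powr real_of_int (fst Q)\<rfloor> = m \<longleftrightarrow>
      t \<in> {real_of_int m * side Q..<real_of_int (m + 1) * side Q}" for t m
    by (auto simp: floor_eq_iff field_simps side_def)
  then show ?thesis
    using assms unfolding dcube_def key_eq_iff Rn_def by (auto simp: PiE_iff extensional_def)
qed

lemma dcube_sets [measurable]: "dcube n Q \<in> sets (leb_base n)"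
proof (cases "length (snd Q) = n")
  case True
  then show ?thesis
    unfolding dcube_eq_box[OF True] by (auto intro!: sets_PiM_I_finite)
next
  case False
  then have "dcube n Q = {}" using length_cube by blast
  then show ?thesis by simp
qed

lemma emeasure_dcube:
  assumes "length (snd Q) = n"
  shows "emeasure (leb_Rn n) (dcube n Q) = ennreal (side Q ^ n)"
proof -
  have "emeasure (leb_base n) (dcube n Q) = ennreal (\<Prod>i<n. side Q)"
    unfolding dcube_eq_box[OF assms]
    by (subst emeasure_box) (auto simp: algebra_simps less_imp_le)
  then show ?thesis by (simp add: leb_Rn_def)
qed

lemma edist_dcube:
  assumes "0 < n" "x \<in> dcube n Q" "y \<in> dcube n Q"
  shows "edist n x y < n * side Q"
proof (rule edist_less[OF assms(1)])
  fix i assume i: "i < n"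
  note box = dcube_eq_box[OF length_cube[OF assms(2)]]
  have "x i \<in> {real_of_int (snd Q ! i) * side Q..<real_of_int (snd Q ! i + 1) * side Q}"
    "y i \<in> {real_of_int (snd Q ! i) * side Q..<real_of_int (snd Q ! i + 1) * side Q}"
    using assms(2,3) i unfolding box by (blast dest: PiE_mem)+
  then show "\<bar>x i - y i\<bar> < side Q"
    by (auto simp: abs_less_iff algebra_simps)
qed

lemma corner_mem:
  assumes "length (snd Q) = n"
  shows "corner n Q \<in> dcube n Q"
  unfolding dcube_eq_box[OF assms] by (auto simp: corner_def)

lemma key_mono:
  assumes "j \<le> j'" "key n j x = key n j y"
  shows "key n j' x = key n j' y"
proof -
  define d where "d = nat (j' - j)"
  have e: "2 powr j' = 2 powr j * real (2 ^ d)"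
    using assms(1) by (simp add: d_def powr_add[symmetric] flip: powr_realpow)
  have fl: "\<lfloor>t / 2 powr j'\<rfloor> = \<lfloor>t / 2 powr j\<rfloor> div 2 ^ d" for t :: real
    using floor_divide_real_eq_div[of "2 ^ d" "t / 2 powr j"] by (simp add: e)
  have "\<lfloor>x i / 2 powr j\<rfloor> = \<lfloor>y i / 2 powr j\<rfloor>" if "i < n" for i
    using assms(2) that by (auto simp: key_def)
  then show ?thesis
    by (simp add: key_def fl)
qed

lemma dcube_nested:
  assumes "x \<in> dcube n Q" "x \<in> dcube n R" "fst Q \<le> fst R"
  shows "dcube n Q \<subseteq> dcube n R"
proof
  fix y assume y: "y \<in> dcube n Q"
  then have "key n (fst Q) y = key n (fst Q) x"
    using assms(1) by (simp add: dcube_def)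
  then have "key n (fst R) y = key n (fst R) x"
    by (rule key_mono[OF assms(3)])
  then show "y \<in> dcube n R"
    using y assms(2) by (simp add: dcube_def)
qed

text \<open>The half space is partitioned into boxes over the dyadic cubes.  A large
  factor \<open>\<kappa>\<close> makes the boxes high in comparison with the cubes below them.\<close>

definition dscale :: "real \<Rightarrow> real \<Rightarrow> int" where
  "dscale \<kappa> t = \<lceil>log 2 (t / \<kappa>)\<rceil>"

definition dindex :: "nat \<Rightarrow> real \<Rightarrow> point \<times> real \<Rightarrow> cube" where
  "dindex n \<kappa> z = (dscale \<kappa> (snd z), key n (dscale \<kappa> (snd z)) (fst z))"

lemma dscale_bounds:
  assumes "0 < \<kappa>" "0 < t"
  shows "t \<le> \<kappa> * 2 powr dscale \<kappa> t" "\<kappa> * 2 powr dscale \<kappa> t < 2 * t"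
proof -
  have "log 2 (t / \<kappa>) \<le> dscale \<kappa> t" and l: "dscale \<kappa> t < log 2 (t / \<kappa>) + 1"
    using ceiling_correct[of "log 2 (t / \<kappa>)"] by (simp_all add: dscale_def)
  then have "t / \<kappa> \<le> 2 powr dscale \<kappa> t"
    using assms by (subst (asm) log_le_iff) auto
  then show "t \<le> \<kappa> * 2 powr dscale \<kappa> t"
    using assms by (simp add: field_simps)
  have "2 powr dscale \<kappa> t < 2 powr (log 2 (t / \<kappa>) + 1)"
    using l by simp
  also have "\<dots> = 2 * (t / \<kappa>)"
    using assms by (simp add: powr_add)
  finally show "\<kappa> * 2 powr dscale \<kappa> t < 2 * t"
    using assms by (simp add: field_simps)
qed

lemma dindex_bounds:
  assumes "0 < \<kappa>" "z \<in> space (half_base n)" "dindex n \<kappa> z = Q"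
  shows "fst z \<in> dcube n Q" "0 < snd z" "snd z \<le> \<kappa> * side Q" "\<kappa> * side Q < 2 * snd z"
proof -
  show "0 < snd z"
    using assms(2) by (auto simp: space_pair_measure space_restrict_space)
  then show "fst z \<in> dcube n Q" "snd z \<le> \<kappa> * side Q" "\<kappa> * side Q < 2 * snd z"
    using dscale_bounds[OF assms(1), of "snd z"] assms(2)
    by (auto simp: space_pair_measure space_leb_base dindex_def dcube_def side_def simp flip: assms(3))
qed

lemma measurable_dindex [measurable]: "dindex n \<kappa> \<in> half_base n \<rightarrow>\<^sub>M count_space UNIV"
proof -
  have "dindex n \<kappa> -` {Q} \<inter> space (half_base n) \<in> sets (half_base n)" for Q
  proof -
    have "dindex n \<kappa> -` {Q} \<inter> space (half_base n) = {z \<in> space (half_base n).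
        length (snd Q) = n \<and> dscale \<kappa> (snd z) = fst Q \<and>
        (\<forall>i\<in>{..<n}. \<lfloor>fst z i / 2 powr real_of_int (fst Q)\<rfloor> = snd Q ! i)}"
      by (auto simp: dindex_def key_eq_iff prod_eq_iff)
    also have "\<dots> \<in> sets (half_base n)"
      unfolding dscale_def by measurable
    finally show ?thesis .
  qed
  then show ?thesis
    by (subst measurable_count_space_eq_countable) auto
qed

lemma measurable_dindex_leb [measurable]: "dindex n \<kappa> \<in> leb_half n \<rightarrow>\<^sub>M count_space UNIV"
  unfolding leb_half_def by (rule measurable_completion) measurable

text \<open>
  Each point of the half space lies in exactly one box, so an integral over the half space is the
  sum of the integrals over the boxes.  The weight \<open>g\<close> selects families of boxes.
\<close>

lemma nn_integral_boxes:
  assumes [measurable]: "f \<in> borel_measurable (leb_half n)"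
  shows "(\<integral>\<^sup>+z. g (dindex n \<kappa> z) * f z \<partial>leb_half n) =
    (\<integral>\<^sup>+Q. g Q * (\<integral>\<^sup>+z. f z * indicator {z. dindex n \<kappa> z = Q} z \<partial>leb_half n) \<partial>count_space UNIV)"
proof -
  have "(\<integral>\<^sup>+Q. g Q * (\<integral>\<^sup>+z. f z * indicator {z. dindex n \<kappa> z = Q} z \<partial>leb_half n) \<partial>count_space UNIV)
      = (\<integral>\<^sup>+Q. \<integral>\<^sup>+z. g Q * (f z * (if dindex n \<kappa> z = Q then 1 else 0)) \<partial>leb_half n \<partial>count_space UNIV)"
    by (intro nn_integral_cong, subst nn_integral_cmult[symmetric])
       (auto intro!: nn_integral_cong simp: indicator_def)
  also have "\<dots> = (\<integral>\<^sup>+z. \<integral>\<^sup>+Q. g Q * (f z * (if dindex n \<kappa> z = Q then 1 else 0)) \<partial>count_space UNIV \<partial>leb_half n)"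
    by (subst nn_integral_count_space_nn_integral) auto
  also have "\<dots> = (\<integral>\<^sup>+z. g (dindex n \<kappa> z) * f z \<partial>leb_half n)"
  proof (rule nn_integral_cong)
    fix z
    have "(\<integral>\<^sup>+Q. g Q * (f z * (if dindex n \<kappa> z = Q then 1 else 0)) \<partial>count_space UNIV)
        = (\<integral>\<^sup>+Q. (g Q * f z) * indicator {dindex n \<kappa> z} Q \<partial>count_space UNIV)"
      by (intro nn_integral_cong) (auto simp: indicator_def)
    also have "\<dots> = g (dindex n \<kappa> z) * f z"
      by (subst nn_integral_indicator_singleton) auto
    finally show "(\<integral>\<^sup>+Q. g Q * (f z * (if dindex n \<kappa> z = Q then 1 else 0)) \<partial>count_space UNIV)
        = g (dindex n \<kappa> z) * f z" .
  qed
  finally show ?thesis ..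
qed

section \<open>The constants\<close>

text \<open>
  The first summand places a box that meets the tent over \<open>\<Omega>\<close> above a cube whose corner has distance at
  least \<open>5 * n * side\<close> from the complement; the second one places a box inside the cones over
  the points of its cube.  Here \<open>n * side\<close> bounds the diameter of a cube.
\<close>

definition box_height :: "nat \<Rightarrow> real \<Rightarrow> real" where
  "box_height n \<beta> = 12 * n / \<beta> + 2 * n"

lemma box_height:
  assumes n: "1 \<le> n" and \<beta>: "0 < \<beta>"
  shows "0 < box_height n \<beta>" "2 * real n \<le> box_height n \<beta>"
    "12 * real n \<le> \<beta> * box_height n \<beta>"
proof -
  have "0 < 12 * real n / \<beta>" using n \<beta> by simp
  then show "0 < box_height n \<beta>" "2 * real n \<le> box_height n \<beta>"
    unfolding box_height_def by simp_all
  have "\<beta> * box_height n \<beta> = 12 * real n + \<beta> * (2 * real n)"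
    using \<beta> unfolding box_height_def by (simp add: distrib_left)
  then show "12 * real n \<le> \<beta> * box_height n \<beta>" using \<beta> by simp
qed

text \<open>
  The radius of the inner ball of an atom divided by the radius of the ball whose tent supports it.
  With this value the cylinder over the inner ball of height \<open>6 / \<beta>\<close> times its radius just fits
  into the tent; it is the solution of \<open>6 / \<beta> * c = 1 - c\<close>.
\<close>

definition inner_ratio :: "real \<Rightarrow> real" where
  "inner_ratio \<beta> = \<beta> / (\<beta> + 6)"

text \<open>
  The inner radius is at most this multiple of the side of the stopping cube.  The first summand
  is the multiple for which the boxes below the cube are exactly as high as \<open>6 / \<beta>\<close> times the
  radius; the second one makes the inequality strict and the ball contain the cube.
\<close>

definition ball_factor :: "nat \<Rightarrow> real \<Rightarrow> real" where
  "ball_factor n \<beta> = \<beta> * box_height n \<beta> / 6 + n"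

text \<open>
  This bounds the volume of the ball of an atom divided by the volume of the stopping cube.
\<close>

definition volume_ratio :: "nat \<Rightarrow> real \<Rightarrow> real" where
  "volume_ratio n \<beta> = (2 * ball_factor n \<beta> / inner_ratio \<beta>) ^ n"

text \<open>
  The factor balances the energy \<open>8 * \<kappa> ^ n * 4 powr k * \<bar>R\<bar>\<close> of a piece against the bound
  \<open>\<bar>B\<bar> powr (1 - 2 / p)\<close> for atoms, with \<open>volume_ratio n \<beta> * \<bar>R\<bar>\<close> in place of \<open>\<bar>B\<bar>\<close>.
  Here \<open>\<kappa>\<close> is the box height, \<open>R\<close> the stopping cube and \<open>B\<close> the ball; see \<open>coefficient_sq\<close>.
\<close>

definition atom_factor :: "nat \<Rightarrow> real \<Rightarrow> real \<Rightarrow> real" where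
  "atom_factor n p \<beta> = sqrt (8 * box_height n \<beta> ^ n) * volume_ratio n \<beta> powr (1 / p - 1 / 2)"

definition decomposition_constant :: "nat \<Rightarrow> real \<Rightarrow> real \<Rightarrow> real" where
  "decomposition_constant n p \<beta> = atom_factor n p \<beta> powr p * (2 / (1 - 2 powr (- p)))"

lemma inner_ratio:
  assumes "0 < \<beta>"
  shows "0 < inner_ratio \<beta>" "inner_ratio \<beta> < 1" "6 / \<beta> * inner_ratio \<beta> = 1 - inner_ratio \<beta>"
  using assms by (simp_all add: inner_ratio_def field_simps)

lemma factors_pos:
  assumes "1 \<le> n" "0 < \<beta>"
  shows "n \<le> ball_factor n \<beta>" "0 < volume_ratio n \<beta>" "0 < atom_factor n p \<beta>"
proof -
  show n: "n \<le> ball_factor n \<beta>"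
    using box_height(1)[OF assms] assms(2) by (simp add: ball_factor_def)
  with assms(1) have "0 < ball_factor n \<beta>" by simp
  then show v: "0 < volume_ratio n \<beta>"
    using inner_ratio(1)[OF assms(2)] by (simp add: volume_ratio_def)
  then show "0 < atom_factor n p \<beta>"
    using box_height(1)[OF assms] by (simp add: atom_factor_def)
qed

lemma decomposition_constant_pos:
  assumes "1 \<le> n" "0 < p" "0 < \<beta>"
  shows "0 < decomposition_constant n p \<beta>"
  using factors_pos(3)[OF assms(1,3), of p] powr_less_mono[of "- p" 0 2] assms(2)
  by (simp add: decomposition_constant_def)

section \<open>Stopping cubes\<close>

text \<open>
  A geometric series: the largest term dominates, and it is at most \<open>u powr (p / 2)\<close>.
\<close>

lemma sum_powers_le:
  fixes F :: "int set" and p :: real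
  assumes F: "finite F" and p: "0 < p" and le: "\<And>k. k \<in> F \<Longrightarrow> ennreal (4 powr k) < u"
  shows "(\<Sum>k\<in>F. ennreal (2 powr (k * p))) \<le> ennreal (1 / (1 - 2 powr (- p))) * epowr u (p / 2)"
proof (cases "F = {}")
  case False
  define q where "q = (2 powr (- p) :: real)"
  have q: "0 < q" "q < 1" using p powr_less_mono[of "- p" 0 2] by (auto simp: q_def)
  define K where "K = Max F"
  have K: "K \<in> F" "\<And>k. k \<in> F \<Longrightarrow> k \<le> K"
    using F False by (auto simp: K_def)
  have pw: "2 powr (k * p) = 2 powr (K * p) * q ^ nat (K - k)" if "k \<in> F" for k
  proof -
    have "q ^ nat (K - k) = 2 powr (- p * (K - k))"
      using K(2)[OF that] unfolding q_def by (simp add: powr_powr flip: powr_realpow)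
    then show ?thesis
      by (simp add: algebra_simps flip: powr_add)
  qed
  have inj: "inj_on (\<lambda>k. nat (K - k)) F"
    using K(2) by (intro inj_onI) (force simp: eq_nat_nat_iff)
  have "(\<Sum>k\<in>F. 2 powr (k * p)) = (\<Sum>k\<in>F. 2 powr (K * p) * q ^ nat (K - k))"
    by (intro sum.cong pw) auto
  also have "\<dots> = 2 powr (K * p) * (\<Sum>i\<in>(\<lambda>k. nat (K - k)) ` F. q ^ i)"
    by (simp add: sum_distrib_left sum.reindex[OF inj])
  also have "\<dots> \<le> 2 powr (K * p) * (\<Sum>i. q ^ i)"
    using q F by (intro mult_left_mono sum_le_suminf) auto
  also have "(\<Sum>i. q ^ i) = 1 / (1 - q)"
    using q by (intro suminf_geometric) auto
  finally have sum: "(\<Sum>k\<in>F. 2 powr (k * p)) \<le> 1 / (1 - q) * 2 powr (K * p)" by simp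
  have "ennreal (2 powr (K * p)) = epowr (ennreal (4 powr K)) (p / 2)"
  proof -
    have "(4::real) powr K = 2 powr (2 * K)"
      using powr_powr[of "2::real" 2 K] by simp
    then show ?thesis by (simp add: epowr_ennreal powr_powr)
  qed
  also have "\<dots> \<le> epowr u (p / 2)"
    using le[OF K(1)] p by (intro epowr_mono) auto
  finally have "ennreal (2 powr (K * p)) \<le> epowr u (p / 2)" .
  then have "ennreal (1 / (1 - q)) * ennreal (2 powr (K * p)) \<le> ennreal (1 / (1 - q)) * epowr u (p / 2)"
    by (intro mult_left_mono) auto
  moreover have "(\<Sum>k\<in>F. ennreal (2 powr (k * p))) \<le> ennreal (1 / (1 - q)) * ennreal (2 powr (K * p))"
    using sum q by (simp add: sum_ennreal ennreal_leI flip: ennreal_mult)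
  ultimately show ?thesis by (simp add: q_def)
qed simp

locale tent_decomposition =
  fixes n :: nat and p \<beta> :: real and U :: "point \<times> real \<Rightarrow> complex" and \<Omega> :: "point set"
  assumes n: "1 \<le> n" and p: "0 < p" "p \<le> 1" and \<beta>: "0 < \<beta>"
    and U [measurable]: "U \<in> borel_measurable (leb_half n)"
    and finite_norm: "(\<integral>\<^sup>+x. epowr (sq_area n U x) (p / 2) \<partial>leb_Rn n) < \<infinity>"
    and supp: "supp_in n U (tent n \<beta> \<Omega>)"
    and compl: "Rn n - \<Omega> \<noteq> {}"
begin

abbreviation \<kappa> :: real where "\<kappa> \<equiv> box_height n \<beta>"

abbreviation index :: "point \<times> real \<Rightarrow> cube" where "index \<equiv> dindex n \<kappa>"

text \<open>
  The threshold \<open>4 powr k\<close> for the square is the threshold \<open>2 powr k\<close> for the area function.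
\<close>

definition level_set :: "int \<Rightarrow> point set" where
  "level_set k = {x \<in> space (leb_Rn n). ennreal (4 powr k) < sq_area n U x}"

definition heavy :: "int \<Rightarrow> cube \<Rightarrow> bool" where
  "heavy k Q \<longleftrightarrow> emeasure (leb_Rn n) (dcube n Q) < 2 * emeasure (leb_Rn n) (dcube n Q \<inter> level_set k)"

text \<open>
  The distance of the corner from the complement of \<open>\<Omega>\<close> is at least five times the bound
  \<open>n * side Q\<close> for the diameter, so a ball around the corner contains the cube while its fivefold
  is still in \<open>\<Omega>\<close>.
\<close>

definition admissible :: "cube \<Rightarrow> bool" where
  "admissible Q \<longleftrightarrow> nball n (corner n Q) (5 * n * side Q) \<subseteq> \<Omega>"

text \<open>
  The flux of a cube is the contribution of its box to the square of the area function, the energy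
  its contribution to the size condition of an atom.
\<close>

definition flux :: "cube \<Rightarrow> ennreal" where
  "flux Q = (\<integral>\<^sup>+z. ennreal ((cmod (U z))\<^sup>2 / snd z ^ (n + 1)) * indicator {z. index z = Q} z \<partial>leb_half n)"

definition energy :: "cube \<Rightarrow> ennreal" where
  "energy Q = (\<integral>\<^sup>+z. ennreal ((cmod (U z))\<^sup>2 / snd z) * indicator {z. index z = Q} z \<partial>leb_half n)"

definition maximal :: "int \<Rightarrow> cube \<Rightarrow> bool" where
  "maximal k R \<longleftrightarrow> length (snd R) = n \<and> admissible R \<and> heavy k R \<and>
     (\<forall>R'. fst R < fst R' \<longrightarrow> dcube n R \<subseteq> dcube n R' \<longrightarrow> \<not> (admissible R' \<and> heavy k R'))"

lemma kappa: "0 < \<kappa>" "2 * real n \<le> \<kappa>" "12 * real n \<le> \<beta> * \<kappa>"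
  using box_height[OF n \<beta>] by auto

lemma space_leb_half': "space (leb_half n) = space (half_base n)"
  by (simp add: leb_half_def)

lemma dcube_leb [measurable]: "dcube n Q \<in> sets (leb_Rn n)"
  by (rule sets_leb_Rn) measurable

lemma level_set_sets [measurable]: "level_set k \<in> sets (leb_Rn n)"
  unfolding level_set_def by measurable

lemma index_mem_tcone:
  assumes "z \<in> space (leb_half n)" "x \<in> dcube n (index z)"
  shows "z \<in> tcone n x"
proof -
  note b = dindex_bounds[OF kappa(1) assms(1)[unfolded space_leb_half'] refl]
  have "edist n (fst z) x < n * side (index z)"
    using n by (intro edist_dcube b assms) auto
  also have "\<dots> = 2 * n * side (index z) / 2" by simp
  also have "\<dots> \<le> \<kappa> * side (index z) / 2"
    using kappa(2) by (intro divide_right_mono mult_right_mono) (auto simp: less_imp_le)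
  also have "\<dots> < snd z" using b(4) by simp
  finally show ?thesis
    using assms(1) by (auto simp: tcone_eq space_leb_half')
qed

text \<open>
  The boxes are disjoint, and those of the cubes containing \<open>x\<close> lie in the cone over \<open>x\<close>.
\<close>

lemma sum_flux_le:
  assumes "x \<in> Rn n"
  shows "(\<integral>\<^sup>+Q. indicator C Q * indicator (dcube n Q) x * flux Q \<partial>count_space UNIV) \<le> sq_area n U x"
proof -
  have "(\<integral>\<^sup>+Q. indicator C Q * indicator (dcube n Q) x * flux Q \<partial>count_space UNIV)
     = (\<integral>\<^sup>+z. (indicator C (index z) * indicator (dcube n (index z)) x) *
          ennreal ((cmod (U z))\<^sup>2 / snd z ^ (n + 1)) \<partial>leb_half n)"
    unfolding flux_def by (rule nn_integral_boxes[symmetric]) (rule measurable_weight[OF U])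
  also have "\<dots> \<le> sq_area n U x"
    unfolding sq_area_def using index_mem_tcone[of _ x]
    by (intro nn_integral_mono) (auto split: split_indicator)
  finally show ?thesis .
qed

lemma flux_le:
  assumes "x \<in> dcube n Q"
  shows "flux Q \<le> sq_area n U x"
proof -
  have "flux Q = (\<integral>\<^sup>+R. flux Q * indicator {Q} R \<partial>count_space UNIV)"
    by (subst nn_integral_indicator_singleton) auto
  also have "\<dots> = (\<integral>\<^sup>+R. indicator {Q} R * indicator (dcube n R) x * flux R \<partial>count_space UNIV)"
    using assms by (intro nn_integral_cong) (auto split: split_indicator)
  also have "\<dots> \<le> sq_area n U x"
    by (rule sum_flux_le) (use assms in \<open>simp add: dcube_def\<close>)
  finally show ?thesis .
qed

text \<open>
  On the box of \<open>Q\<close> the height is at most \<open>\<kappa> * side Q\<close>, which trades \<open>1 / t\<close> for \<open>1 / t ^ (n + 1)\<close>.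
\<close>

lemma energy_le_flux: "energy Q \<le> ennreal (\<kappa> ^ n * side Q ^ n) * flux Q"
proof -
  have "energy Q \<le> (\<integral>\<^sup>+z. ennreal (\<kappa> ^ n * side Q ^ n) *
      (ennreal ((cmod (U z))\<^sup>2 / snd z ^ (n + 1)) * indicator {z. index z = Q} z) \<partial>leb_half n)"
    unfolding energy_def
  proof (rule nn_integral_mono)
    fix z assume z: "z \<in> space (leb_half n)"
    show "ennreal ((cmod (U z))\<^sup>2 / snd z) * indicator {z. index z = Q} z \<le> ennreal (\<kappa> ^ n * side Q ^ n) *
      (ennreal ((cmod (U z))\<^sup>2 / snd z ^ (n + 1)) * indicator {z. index z = Q} z)"
    proof (cases "index z = Q")
      case True
      note b = dindex_bounds[OF kappa(1) z[unfolded space_leb_half'] True]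
      have "snd z ^ n \<le> \<kappa> ^ n * side Q ^ n"
        using power_mono[OF b(3), of n] b(2) by (simp add: power_mult_distrib)
      then have "snd z ^ n * ((cmod (U z))\<^sup>2 / snd z ^ (n + 1))
          \<le> (\<kappa> ^ n * side Q ^ n) * ((cmod (U z))\<^sup>2 / snd z ^ (n + 1))"
        using b(2) by (intro mult_right_mono) auto
      then have "(cmod (U z))\<^sup>2 / snd z \<le> (\<kappa> ^ n * side Q ^ n) * ((cmod (U z))\<^sup>2 / snd z ^ (n + 1))"
        using b(2) by simp
      then show ?thesis
        using True b(2) kappa(1) by (simp add: ennreal_leI less_imp_le flip: ennreal_mult)
    qed simp
  qed
  also have "\<dots> = ennreal (\<kappa> ^ n * side Q ^ n) * flux Q"
    unfolding flux_def using measurable_weight[OF U, of "n + 1"]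
    by (subst nn_integral_cmult) auto
  finally show ?thesis .
qed

text \<open>
  A cube that is not heavy has at least half of its volume outside the level set.  Its energy is at
  most a multiple of its volume times its flux, hence of the integral of its flux over this half.
  Summing over the cubes inside the integral leaves the sum of the fluxes of the cubes containing
  a given point, and this is at most the square of the area function, thus \<open>4 powr k\<close>.
\<close>

lemma energy_sum_le:
  fixes k :: int
  assumes C: "\<And>Q. Q \<in> C \<Longrightarrow> length (snd Q) = n \<and> dcube n Q \<subseteq> R \<and> \<not> heavy k Q"
    and R [measurable]: "R \<in> sets (leb_Rn n)"
  shows "(\<integral>\<^sup>+z. indicator C (index z) * ennreal ((cmod (U z))\<^sup>2 / snd z) \<partial>leb_half n)
    \<le> ennreal (2 * \<kappa> ^ n * 4 powr k) * emeasure (leb_Rn n) R"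
proof -
  let ?\<mu> = "emeasure (leb_Rn n)"
  let ?c = "ennreal (2 * \<kappa> ^ n)"
  have [measurable]: "(\<lambda>z. ennreal ((cmod (U z))\<^sup>2 / snd z)) \<in> borel_measurable (leb_half n)"
    using measurable_weight[OF U, of 1] by simp
  \<comment> \<open>The contribution of a single cube, as an integral over the part of \<open>R\<close> outside the level set.\<close>
  have one: "indicator C Q * energy Q \<le> (\<integral>\<^sup>+x. ?c * (indicator (R - level_set k) x *
      (indicator C Q * indicator (dcube n Q) x * flux Q)) \<partial>leb_Rn n)" for Q
  proof (cases "Q \<in> C")
    case True
    have v: "?\<mu> (dcube n Q) = ennreal (side Q ^ n)"
      using C[OF True] by (simp add: emeasure_dcube)
    have split: "?\<mu> (dcube n Q) = ?\<mu> (dcube n Q \<inter> level_set k) + ?\<mu> (dcube n Q - level_set k)"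
      by (subst plus_emeasure) (auto intro!: arg_cong[where f="?\<mu>"])
    have "2 * ?\<mu> (dcube n Q \<inter> level_set k) \<le> ?\<mu> (dcube n Q)"
      using C[OF True] by (simp add: heavy_def not_less)
    then have "?\<mu> (dcube n Q) \<le> 2 * ?\<mu> (dcube n Q - level_set k)"
      using split v
      by (cases "?\<mu> (dcube n Q \<inter> level_set k)"; cases "?\<mu> (dcube n Q - level_set k)")
         (auto simp: ennreal_mult_top simp flip: ennreal_plus ennreal_numeral ennreal_mult)
    then have "ennreal (\<kappa> ^ n) * ennreal (side Q ^ n) \<le> ennreal (\<kappa> ^ n) * (2 * ?\<mu> (dcube n Q - level_set k))"
      unfolding v by (rule mult_left_mono) simp
    also have "\<dots> = ?c * ?\<mu> (dcube n Q - level_set k)"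
      using kappa(1) by (simp add: ennreal_mult mult.assoc mult.left_commute)
    finally have "ennreal (\<kappa> ^ n * side Q ^ n) * flux Q \<le> ?c * ?\<mu> (dcube n Q - level_set k) * flux Q"
      using kappa(1) by (intro mult_right_mono) (simp_all add: ennreal_mult less_imp_le)
    also have "\<dots> = (\<integral>\<^sup>+x. ?c * flux Q * indicator (dcube n Q - level_set k) x \<partial>leb_Rn n)"
      by (subst nn_integral_cmult_indicator) (auto simp: mult_ac)
    also have "\<dots> = (\<integral>\<^sup>+x. ?c * (indicator (R - level_set k) x *
        (indicator C Q * indicator (dcube n Q) x * flux Q)) \<partial>leb_Rn n)"
      using C[OF True] True by (intro nn_integral_cong) (auto split: split_indicator)
    finally show ?thesis
      using energy_le_flux[of Q] True by simp
  qed simp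
  have "(\<integral>\<^sup>+z. indicator C (index z) * ennreal ((cmod (U z))\<^sup>2 / snd z) \<partial>leb_half n)
    = (\<integral>\<^sup>+Q. indicator C Q * energy Q \<partial>count_space UNIV)"
    unfolding energy_def by (rule nn_integral_boxes) measurable
  also have "\<dots> \<le> (\<integral>\<^sup>+Q. \<integral>\<^sup>+x. ?c * (indicator (R - level_set k) x *
      (indicator C Q * indicator (dcube n Q) x * flux Q)) \<partial>leb_Rn n \<partial>count_space UNIV)"
    by (intro nn_integral_mono one)
  also have "\<dots> = (\<integral>\<^sup>+x. \<integral>\<^sup>+Q. ?c * (indicator (R - level_set k) x *
      (indicator C Q * indicator (dcube n Q) x * flux Q)) \<partial>count_space UNIV \<partial>leb_Rn n)"
    by (subst nn_integral_count_space_nn_integral) auto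
  also have "\<dots> = (\<integral>\<^sup>+x. ?c * (indicator (R - level_set k) x *
      (\<integral>\<^sup>+Q. indicator C Q * indicator (dcube n Q) x * flux Q \<partial>count_space UNIV)) \<partial>leb_Rn n)"
    by (simp add: nn_integral_cmult)
  also have "\<dots> \<le> (\<integral>\<^sup>+x. ?c * ennreal (4 powr k) * indicator R x \<partial>leb_Rn n)"
  proof (rule nn_integral_mono)
    fix x assume x: "x \<in> space (leb_Rn n)"
    have "(\<integral>\<^sup>+Q. indicator C Q * indicator (dcube n Q) x * flux Q \<partial>count_space UNIV) \<le> ennreal (4 powr k)"
      if "x \<notin> level_set k"
      using order_trans[OF sum_flux_le[of x C], of "ennreal (4 powr k)"] that x
      by (simp add: level_set_def space_leb_Rn not_less)
    then show "?c * (indicator (R - level_set k) x *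
      (\<integral>\<^sup>+Q. indicator C Q * indicator (dcube n Q) x * flux Q \<partial>count_space UNIV))
      \<le> ?c * ennreal (4 powr k) * indicator R x"
      by (auto split: split_indicator intro!: mult_left_mono)
  qed
  also have "\<dots> = ennreal (2 * \<kappa> ^ n * 4 powr k) * ?\<mu> R"
    using kappa(1) by (simp add: nn_integral_cmult_indicator ennreal_mult)
  finally show ?thesis .
qed

lemma level_set_bound:
  fixes k :: int
  shows
  "ennreal (2 powr (k * p)) * emeasure (leb_Rn n) (level_set k)
    \<le> (\<integral>\<^sup>+x. epowr (sq_area n U x) (p / 2) \<partial>leb_Rn n)"
proof -
  have e: "ennreal (2 powr (k * p)) = epowr (ennreal (4 powr k)) (p / 2)"
    using powr_powr[of "2::real" 2 k] by (simp add: epowr_ennreal powr_powr)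
  have "ennreal (2 powr (k * p)) * emeasure (leb_Rn n) (level_set k)
    = (\<integral>\<^sup>+x. ennreal (2 powr (k * p)) * indicator (level_set k) x \<partial>leb_Rn n)"
    by (simp add: nn_integral_cmult_indicator)
  also have "\<dots> \<le> (\<integral>\<^sup>+x. epowr (sq_area n U x) (p / 2) \<partial>leb_Rn n)"
    unfolding e using p
    by (intro nn_integral_mono) (auto simp: level_set_def split: split_indicator intro!: epowr_mono)
  finally show ?thesis .
qed

text \<open>
  A heavy cube has less than twice the volume of the level set, which Chebyshev's inequality
  controls.  This bounds the size of the heavy cubes of a given level as well as the levels for
  which a given cube is heavy.
\<close>

lemma heavy_bound:
  assumes "heavy k Q" "length (snd Q) = n"
  shows "2 powr (k * p) * side Q ^ n
    \<le> 2 * enn2real (\<integral>\<^sup>+x. epowr (sq_area n U x) (p / 2) \<partial>leb_Rn n)"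
proof -
  let ?N = "\<integral>\<^sup>+x. epowr (sq_area n U x) (p / 2) \<partial>leb_Rn n"
  have "ennreal (side Q ^ n) \<le> 2 * emeasure (leb_Rn n) (dcube n Q \<inter> level_set k)"
    using assms by (simp add: heavy_def emeasure_dcube)
  also have "\<dots> \<le> 2 * emeasure (leb_Rn n) (level_set k)"
    by (intro mult_left_mono emeasure_mono) auto
  finally have "ennreal (2 powr (k * p)) * ennreal (side Q ^ n)
      \<le> ennreal (2 powr (k * p)) * (2 * emeasure (leb_Rn n) (level_set k))"
    by (rule mult_left_mono) simp
  also have "\<dots> = 2 * (ennreal (2 powr (k * p)) * emeasure (leb_Rn n) (level_set k))"
    by (simp add: mult_ac)
  also have "\<dots> \<le> 2 * ?N"
    by (intro mult_left_mono level_set_bound) simp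
  also have "\<dots> = ennreal (2 * enn2real ?N)"
    using finite_norm by (simp add: ennreal_mult less_top)
  finally show ?thesis
    by (simp add: less_imp_le flip: ennreal_mult)
qed

text \<open>
  The flux is a lower bound for the square of the area function on the whole cube, so the cube is
  contained in the level sets of very negative levels.  Large levels are excluded by \<open>heavy_bound\<close>.
\<close>

lemma ex_last_heavy:
  assumes "0 < flux Q" "x \<in> dcube n Q"
  shows "\<exists>k. heavy k Q \<and> \<not> heavy (k + 1) Q"
proof -
  let ?N = "enn2real (\<integral>\<^sup>+x. epowr (sq_area n U x) (p / 2) \<partial>leb_Rn n)"
  have len: "length (snd Q) = n" using assms(2) by (rule length_cube)
  obtain e where e: "0 < e" "ennreal e < flux Q"
  proof -
    obtain y where y: "0 < y" "y < flux Q" using dense[OF assms(1)] by blast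
    then have "y = ennreal (enn2real y)" by (simp add: less_top order.strict_trans2)
    then show ?thesis using y that[of "enn2real y"] by (metis ennreal_less_zero_iff)
  qed
  define k0 where "k0 = \<lfloor>log 4 e\<rfloor>"
  have "4 powr k0 \<le> e"
    using e(1) by (subst le_log_iff[symmetric]) (auto simp: k0_def)
  then have "ennreal (4 powr k0) < flux Q"
    using e by (meson ennreal_leI le_less_trans)
  then have "dcube n Q \<subseteq> level_set k0"
    using flux_le[of _ Q] by (auto simp: level_set_def dcube_def space_leb_Rn intro: less_le_trans)
  then have "dcube n Q \<inter> level_set k0 = dcube n Q" by blast
  moreover have "ennreal (side Q ^ n) < ennreal (2 * side Q ^ n)"
    by (rule ennreal_lessI) simp_all
  ultimately have k0: "heavy k0 Q"
    by (simp add: heavy_def emeasure_dcube[OF len] ennreal_mult less_imp_le)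
  define k1 where "k1 = max k0 (\<lceil>log 2 ((2 * ?N + 1) / side Q ^ n) / p\<rceil>)"
  have v: "0 < side Q ^ n" "0 \<le> ?N" by auto
  have "log 2 ((2 * ?N + 1) / side Q ^ n) / p \<le> k1"
    by (simp add: k1_def) linarith
  then have "log 2 ((2 * ?N + 1) / side Q ^ n) \<le> k1 * p"
    using p by (simp add: field_simps)
  then have "(2 * ?N + 1) / side Q ^ n \<le> 2 powr (k1 * p)"
    using v by (subst (asm) log_le_iff) (auto intro!: divide_pos_pos add_nonneg_pos)
  then have "2 * ?N + 1 \<le> 2 powr (k1 * p) * side Q ^ n"
    using v by (simp add: field_simps)
  then have k1: "\<not> heavy k1 Q"
    using heavy_bound[OF _ len, of k1] by fastforce
  show ?thesis
  proof (rule ccontr)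
    assume "\<not> ?thesis"
    then have step: "heavy k Q \<Longrightarrow> heavy (k + 1) Q" for k by blast
    have "k0 \<le> k1" by (simp add: k1_def)
    then have "heavy k1 Q"
      by (induction rule: int_ge_induct) (auto intro: k0 step)
    with k1 show False by simp
  qed
qed

text \<open>
  The dyadic cubes containing \<open>x\<close> form a chain, and \<open>heavy_bound\<close> leaves only finitely many of them
  above \<open>Q\<close>.
\<close>

lemma ex_maximal:
  assumes "heavy k Q" "admissible Q" "x \<in> dcube n Q"
  shows "\<exists>R. maximal k R \<and> fst Q \<le> fst R \<and> dcube n Q \<subseteq> dcube n R"
proof -
  let ?N = "enn2real (\<integral>\<^sup>+x. epowr (sq_area n U x) (p / 2) \<partial>leb_Rn n)"
  let ?R = "\<lambda>j. (j, key n j x)"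
  have x: "x \<in> dcube n (?R j)" for j
    using assms(3) by (simp add: dcube_def)
  have Q: "?R (fst Q) = Q"
    using assms(3) by (auto simp: dcube_def)
  define J where "J = {j. fst Q \<le> j \<and> admissible (?R j) \<and> heavy k (?R j)}"
  have "J \<subseteq> {fst Q..\<lceil>2 * ?N / 2 powr (k * p)\<rceil>}"
  proof
    fix j assume j: "j \<in> J"
    have "2 powr (k * p) * side (?R j) ^ n \<le> 2 * ?N"
      using j length_cube[OF x] by (intro heavy_bound) (auto simp: J_def)
    then have *: "side (?R j) ^ n \<le> 2 * ?N / 2 powr (k * p)"
      by (simp add: field_simps)
    have "j \<le> 2 * ?N / 2 powr (k * p)"
    proof (cases "0 \<le> j")
      case True
      have "real_of_int j \<le> 2 powr j"
      proof -
        have "real (nat j) \<le> 2 ^ nat j" by (rule less_imp_le[OF of_nat_less_two_power])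
        then show ?thesis using True by (simp add: powr_real_of_int)
      qed
      also have "\<dots> \<le> (2 powr j) ^ n"
        using n True by (intro self_le_power) (auto simp: ge_one_powr_ge_zero)
      finally show ?thesis using * by (simp add: side_def)
    next
      case False
      then have "real_of_int j \<le> 0" by simp
      also have "0 \<le> 2 * ?N / 2 powr (k * p)" by simp
      finally show ?thesis .
    qed
    then show "j \<in> {fst Q..\<lceil>2 * ?N / 2 powr (k * p)\<rceil>}"
      using j by (simp add: J_def le_ceiling_iff)
  qed
  then have "finite J" by (rule finite_subset) simp
  moreover have "fst Q \<in> J"
    using assms Q by (simp add: J_def)
  ultimately have M: "Max J \<in> J" "\<And>j. j \<in> J \<Longrightarrow> j \<le> Max J" by (auto intro: Max_in)
  have "maximal k (?R (Max J))"
    unfolding maximal_def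
  proof (intro conjI allI impI notI)
    show "length (snd (?R (Max J))) = n" using x by (rule length_cube)
    show "admissible (?R (Max J))" "heavy k (?R (Max J))" using M(1) by (auto simp: J_def)
    fix R' assume R': "fst (?R (Max J)) < fst R'" "dcube n (?R (Max J)) \<subseteq> dcube n R'"
      and "admissible R' \<and> heavy k R'"
    moreover have "R' = ?R (fst R')"
      using R'(2) x[of "Max J"] by (auto simp: dcube_def prod_eq_iff)
    ultimately have "fst R' \<in> J"
      using M(1) by (auto simp: J_def)
    with M(2) R'(1) show False by fastforce
  qed
  moreover have "dcube n Q \<subseteq> dcube n (?R (Max J))"
    using M(1) by (intro dcube_nested[OF assms(3) x]) (auto simp: J_def)
  moreover have "fst Q \<le> fst (?R (Max J))"
    using M(1) by (simp add: J_def)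
  ultimately show ?thesis by blast
qed

lemma maximal_disjoint:
  assumes "maximal k R" "maximal k R'" "x \<in> dcube n R" "x \<in> dcube n R'"
  shows "R = R'"
proof (rule ccontr)
  assume ne: "R \<noteq> R'"
  then have "fst R \<noteq> fst R'"
    using assms(3,4) by (auto simp: dcube_def prod_eq_iff)
  then consider "fst R < fst R'" | "fst R' < fst R" by linarith
  then show False
  proof cases
    case 1
    with assms dcube_nested[of x n R R'] show ?thesis
      unfolding maximal_def by (metis less_imp_le)
  next
    case 2
    with assms dcube_nested[of x n R' R] show ?thesis
      unfolding maximal_def by (metis less_imp_le)
  qed
qed

text \<open>
  A heavy cube has at most twice the volume of its part in the level set.  The sum of the volumes
  of these parts is an integral; at a point \<open>x\<close> at most one maximal cube of each level occurs in
  the integrand, and only levels with \<open>4 powr k\<close> below the square of the area function at \<open>x\<close>.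
\<close>

lemma sum_maximal_le:
  fixes I :: "(int \<times> cube) set"
  assumes I: "finite I" "\<And>k R. (k, R) \<in> I \<Longrightarrow> maximal k R"
  shows "(\<Sum>(k, R)\<in>I. ennreal (2 powr (real_of_int k * p)) * emeasure (leb_Rn n) (dcube n R))
    \<le> ennreal (2 / (1 - 2 powr (- p))) * (\<integral>\<^sup>+x. epowr (sq_area n U x) (p / 2) \<partial>leb_Rn n)"
proof -
  let ?\<mu> = "emeasure (leb_Rn n)"
  let ?c = "ennreal (1 / (1 - 2 powr (- p)))"
  have c: "0 < 1 - 2 powr (- p)" using p powr_less_mono[of "- p" 0 2] by simp
  have mx: "maximal (fst a) (snd a)" if "a \<in> I" for a
    using I(2)[of "fst a" "snd a"] that by simp
  have heavy: "?\<mu> (dcube n R) \<le> 2 * ?\<mu> (dcube n R \<inter> level_set k)" if "(k, R) \<in> I" for k R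
    using I(2)[OF that] by (simp add: maximal_def heavy_def less_imp_le)
  have "(\<Sum>(k, R)\<in>I. ennreal (2 powr (real_of_int k * p)) * ?\<mu> (dcube n R))
    \<le> (\<Sum>(k, R)\<in>I. ennreal (2 powr (real_of_int k * p)) * (2 * ?\<mu> (dcube n R \<inter> level_set k)))"
    by (intro sum_mono) (auto intro!: mult_left_mono heavy)
  also have "\<dots> = 2 * (\<Sum>(k, R)\<in>I. \<integral>\<^sup>+x. ennreal (2 powr (real_of_int k * p)) * indicator (dcube n R \<inter> level_set k) x \<partial>leb_Rn n)"
    by (simp add: sum_distrib_left nn_integral_cmult_indicator mult_ac split_def)
  also have "\<dots> = 2 * (\<integral>\<^sup>+x. (\<Sum>(k, R)\<in>I. ennreal (2 powr (real_of_int k * p)) * indicator (dcube n R \<inter> level_set k) x) \<partial>leb_Rn n)"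
    unfolding split_def by (subst nn_integral_sum) auto
  also have "\<dots> \<le> 2 * (\<integral>\<^sup>+x. ?c * epowr (sq_area n U x) (p / 2) \<partial>leb_Rn n)"
  proof (intro mult_left_mono nn_integral_mono)
    fix x
    let ?J = "{a \<in> I. x \<in> dcube n (snd a) \<inter> level_set (fst a)}"
    have fin: "finite ?J" using I(1) by (rule rev_finite_subset) auto
    have inj: "inj_on fst ?J"
    proof (rule inj_onI)
      fix a b assume "a \<in> ?J" "b \<in> ?J" "fst a = fst b"
      then show "a = b"
        using maximal_disjoint[of "fst a" "snd a" "snd b" x] mx[of a] mx[of b]
        by (intro prod_eqI) auto
    qed
    have "(\<Sum>(k, R)\<in>I. ennreal (2 powr (real_of_int k * p)) * indicator (dcube n R \<inter> level_set k) x)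
        = (\<Sum>a\<in>?J. ennreal (2 powr (real_of_int (fst a) * p)))"
      by (rule sum.mono_neutral_cong_right) (use I(1) in \<open>auto simp: indicator_def split: if_splits\<close>)
    also have "\<dots> = (\<Sum>k\<in>fst ` ?J. ennreal (2 powr (k * p)))"
      by (subst sum.reindex[OF inj]) (simp add: o_def)
    also have "\<dots> \<le> ?c * epowr (sq_area n U x) (p / 2)"
      by (rule sum_powers_le) (use fin p in \<open>auto simp: level_set_def\<close>)
    finally show "(\<Sum>(k, R)\<in>I. ennreal (2 powr (real_of_int k * p)) * indicator (dcube n R \<inter> level_set k) x)
      \<le> ?c * epowr (sq_area n U x) (p / 2)" .
  qed simp
  also have "\<dots> = 2 * ?c * (\<integral>\<^sup>+x. epowr (sq_area n U x) (p / 2) \<partial>leb_Rn n)"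
    by (subst nn_integral_cmult) (auto simp: mult.assoc)
  also have "2 * ?c = ennreal (2 / (1 - 2 powr (- p)))"
    using c by (simp flip: ennreal_numeral ennreal_mult)
  finally show ?thesis .
qed

section \<open>The pieces of the decomposition\<close>

lemma tentD:
  assumes "z \<in> tent n \<beta> \<Omega>" "w \<in> Rn n" "w \<notin> \<Omega>"
  shows "\<beta> * snd z \<le> edist n (fst z) w"
proof -
  have "ereal (\<beta> * snd z) \<le> (INF w\<in>Rn n - \<Omega>. ereal (edist n (fst z) w))"
    using assms(1) by (auto simp: tent_def)
  also have "\<dots> \<le> ereal (edist n (fst z) w)"
    using assms(2,3) by (intro INF_lower) auto
  finally show ?thesis by simp
qed

text \<open>
  These are the cubes whose boxes matter: almost every point with \<open>U z \<noteq> 0\<close> is in the box of a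
  good cube (\<open>AE_good\<close>).
\<close>

definition good :: "cube \<Rightarrow> bool" where
  "good Q \<longleftrightarrow> 0 < flux Q \<and> (\<exists>z\<in>tent n \<beta> \<Omega>. index z = Q)"

lemma tent_subset_space: "z \<in> tent n \<beta> \<Omega> \<Longrightarrow> z \<in> space (half_base n)"
  by (auto simp: tent_def space_pair_measure space_leb_base space_restrict_space)

text \<open>
  A point of the tent at height about \<open>\<kappa> * side Q\<close> is at distance at least about \<open>\<beta> * \<kappa> * side Q\<close>
  from the complement, and \<open>\<beta> * \<kappa>\<close> is large compared with \<open>n\<close>.
\<close>

lemma good_admissible:
  assumes "good Q"
  shows "admissible Q"
  unfolding admissible_def
proof
  obtain z where z: "z \<in> tent n \<beta> \<Omega>" "index z = Q"
    using assms by (auto simp: good_def)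
  note b = dindex_bounds[OF kappa(1) tent_subset_space[OF z(1)] z(2)]
  fix w assume w: "w \<in> nball n (corner n Q) (5 * n * side Q)"
  show "w \<in> \<Omega>"
  proof (rule ccontr)
    assume "w \<notin> \<Omega>"
    then have "\<beta> * snd z \<le> edist n (fst z) w"
      using w by (intro tentD[OF z(1)]) (auto simp: mem_nball)
    also have "\<dots> \<le> edist n (fst z) (corner n Q) + edist n (corner n Q) w"
      by (rule edist_triangle)
    also have "\<dots> < n * side Q + 5 * n * side Q"
      using w n by (intro add_strict_mono edist_dcube b corner_mem length_cube[OF b(1)])
        (auto simp: mem_nball)
    also have "\<dots> = (12 * n) * side Q / 2" by simp
    also have "\<dots> \<le> (\<beta> * \<kappa>) * side Q / 2"
      using kappa(3) by (intro divide_right_mono mult_right_mono) (auto simp: less_imp_le)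
    also have "\<dots> = \<beta> * (\<kappa> * side Q / 2)" by simp
    also have "\<dots> < \<beta> * snd z"
      using b(4) \<beta> by (intro mult_strict_left_mono) auto
    finally show False .
  qed
qed

text \<open>
  The level at which a good cube stops being heavy and the stopping cube, the maximal cube above
  it for that level.
\<close>

definition stop :: "cube \<Rightarrow> int \<times> cube" where
  "stop Q = (SOME s. \<not> heavy (fst s + 1) Q \<and> maximal (fst s) (snd s) \<and>
     fst Q \<le> fst (snd s) \<and> dcube n Q \<subseteq> dcube n (snd s))"

lemma good_nonempty:
  assumes "good Q"
  obtains x where "x \<in> dcube n Q"
proof -
  obtain z where z: "z \<in> tent n \<beta> \<Omega>" "index z = Q"
    using assms by (auto simp: good_def)
  show ?thesis
    using that[OF dindex_bounds(1)[OF kappa(1) tent_subset_space[OF z(1)] z(2)]] .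
qed

lemma stop:
  assumes "good Q" "stop Q = (k, R)"
  shows "\<not> heavy (k + 1) Q" "maximal k R" "fst Q \<le> fst R" "dcube n Q \<subseteq> dcube n R"
proof -
  obtain x where x: "x \<in> dcube n Q" using assms(1) by (rule good_nonempty)
  have "\<exists>s. \<not> heavy (fst s + 1) Q \<and> maximal (fst s) (snd s) \<and>
     fst Q \<le> fst (snd s) \<and> dcube n Q \<subseteq> dcube n (snd s)"
  proof -
    obtain k where k: "heavy k Q" "\<not> heavy (k + 1) Q"
      using ex_last_heavy[OF _ x] assms(1) by (auto simp: good_def)
    moreover obtain R where "maximal k R \<and> fst Q \<le> fst R \<and> dcube n Q \<subseteq> dcube n R"
      using ex_maximal[OF k(1) good_admissible[OF assms(1)] x] by blast
    ultimately show ?thesis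
      by (intro exI[of _ "(k, R)"]) simp
  qed
  from someI_ex[OF this, folded stop_def]
  show "\<not> heavy (k + 1) Q" "maximal k R" "fst Q \<le> fst R" "dcube n Q \<subseteq> dcube n R"
    using assms(2) by simp_all
qed

text \<open>
  The pairs of a level and a stopping cube are numbered by \<open>to_nat\<close>.  Numbers that code no
  pair of a good cube get an empty family and contribute zero to the decomposition.
\<close>

definition family :: "nat \<Rightarrow> cube set" where
  "family i = {Q. good Q \<and> to_nat (stop Q) = i}"

definition level :: "nat \<Rightarrow> int" where
  "level i = fst (from_nat i :: int \<times> cube)"

definition top_cube :: "nat \<Rightarrow> cube" where
  "top_cube i = snd (from_nat i :: int \<times> cube)"

definition piece :: "nat \<Rightarrow> point \<times> real \<Rightarrow> complex" where
  "piece i z = (if index z \<in> family i then U z else 0)"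

lemma family:
  assumes "Q \<in> family i"
  shows "good Q" "\<not> heavy (level i + 1) Q" "maximal (level i) (top_cube i)"
    "fst Q \<le> fst (top_cube i)" "dcube n Q \<subseteq> dcube n (top_cube i)"
    "to_nat (level i, top_cube i) = i"
proof -
  show "good Q" using assms by (simp add: family_def)
  moreover have s: "stop Q = (level i, top_cube i)"
    using assms by (auto simp: family_def level_def top_cube_def)
  ultimately show "\<not> heavy (level i + 1) Q" "maximal (level i) (top_cube i)"
    "fst Q \<le> fst (top_cube i)" "dcube n Q \<subseteq> dcube n (top_cube i)"
    using stop by auto
  show "to_nat (level i, top_cube i) = i"
    using assms s by (simp add: family_def)
qed

lemma measurable_piece [measurable]: "piece i \<in> borel_measurable (leb_half n)"
  unfolding piece_def by measurable

lemma piece_energy: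
  assumes "Q \<in> family i"
  shows "(\<integral>\<^sup>+z. ennreal ((cmod (piece i z))\<^sup>2 / snd z) \<partial>leb_half n)
    \<le> ennreal (8 * \<kappa> ^ n * 4 powr level i * side (top_cube i) ^ n)"
proof -
  let ?R = "top_cube i"
  have len: "length (snd ?R) = n"
    using family(3)[OF assms] by (simp add: maximal_def)
  have "(\<integral>\<^sup>+z. ennreal ((cmod (piece i z))\<^sup>2 / snd z) \<partial>leb_half n)
    = (\<integral>\<^sup>+z. indicator (family i) (index z) * ennreal ((cmod (U z))\<^sup>2 / snd z) \<partial>leb_half n)"
    by (intro nn_integral_cong) (auto simp: piece_def)
  also have "\<dots> \<le> ennreal (2 * \<kappa> ^ n * 4 powr (level i + 1)) * emeasure (leb_Rn n) (dcube n ?R)"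
  proof (rule energy_sum_le)
    fix Q assume Q: "Q \<in> family i"
    obtain x where "x \<in> dcube n Q" using family(1)[OF Q] by (rule good_nonempty)
    then show "length (snd Q) = n \<and> dcube n Q \<subseteq> dcube n ?R \<and> \<not> heavy (level i + 1) Q"
      using family[OF Q] length_cube by auto
  qed measurable
  also have "\<dots> = ennreal (8 * \<kappa> ^ n * 4 powr level i * side ?R ^ n)"
    using kappa(1) by (simp add: emeasure_dcube[OF len] powr_add less_imp_le mult_ac flip: ennreal_mult)
  finally show ?thesis .
qed

lemma AE_tent_of_piece: "AE z in leb_half n. piece i z \<noteq> 0 \<longrightarrow>
    z \<in> tent n \<beta> \<Omega> \<and> fst z \<in> dcube n (top_cube i) \<and> snd z \<le> \<kappa> * side (top_cube i)"
  using supp[unfolded supp_in_def] AE_space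
proof eventually_elim
  case (elim z)
  show ?case
  proof
    assume "piece i z \<noteq> 0"
    then have Q: "index z \<in> family i" and "U z \<noteq> 0"
      by (auto simp: piece_def split: if_splits)
    note b = dindex_bounds[OF kappa(1) elim(2)[unfolded space_leb_half'] refl]
    have "side (index z) \<le> side (top_cube i)"
      using family(4)[OF Q] by (simp add: side_def)
    then have "\<kappa> * side (index z) \<le> \<kappa> * side (top_cube i)"
      using kappa(1) by simp
    then show "z \<in> tent n \<beta> \<Omega> \<and> fst z \<in> dcube n (top_cube i) \<and> snd z \<le> \<kappa> * side (top_cube i)"
      using elim(1) \<open>U z \<noteq> 0\<close> family(5)[OF Q] b by auto
  qed
qed

lemma AE_good: "AE z in leb_half n. U z \<noteq> 0 \<longrightarrow> good (index z)"
proof -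
  have "AE z in leb_half n. index z = Q \<longrightarrow> flux Q = 0 \<longrightarrow> U z = 0" for Q
  proof (cases "flux Q = 0")
    case True
    have "AE z in leb_half n. ennreal ((cmod (U z))\<^sup>2 / snd z ^ (n + 1)) * indicator {z. index z = Q} z = 0"
      using True measurable_weight[OF U, of "n + 1"] unfolding flux_def
      by (subst (asm) nn_integral_0_iff_AE) auto
    then show ?thesis using AE_space
    proof eventually_elim
      case (elim z)
      have "0 < snd z"
        using elim(2) dindex_bounds(2)[OF kappa(1), of z n] by (simp add: space_leb_half')
      then have "\<not> snd z * snd z ^ n \<le> 0" by (simp add: not_le)
      then show ?case
        using elim(1) by (auto simp: ennreal_eq_0_iff divide_le_0_iff split: split_indicator_asm)
    qed
  qed simp
  then have "AE z in leb_half n. \<forall>Q. index z = Q \<longrightarrow> flux Q = 0 \<longrightarrow> U z = 0"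
    unfolding AE_all_countable by blast
  then show ?thesis
    using supp[unfolded supp_in_def]
    by eventually_elim (auto simp: good_def zero_less_iff_neq_zero)
qed

definition remainder :: "nat \<Rightarrow> point \<times> real \<Rightarrow> complex" where
  "remainder N z = U z - (\<Sum>i<N. piece i z)"

text \<open>
  A box belongs to at most one family, so at most one piece is nonzero at a given point.
\<close>

lemma remainder_eq:
  "remainder N z = (if good (index z) \<and> to_nat (stop (index z)) < N then 0 else U z)"
proof -
  have "(\<Sum>i<N. piece i z) = (\<Sum>i<N. if i = to_nat (stop (index z)) then if good (index z) then U z else 0 else 0)"
    by (intro sum.cong) (auto simp: piece_def family_def)
  then show ?thesis by (auto simp: remainder_def)
qed

lemma measurable_remainder [measurable]: "remainder N \<in> borel_measurable (leb_half n)"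
  unfolding remainder_def by measurable

lemma sq_area_remainder_le: "sq_area n (remainder N) x \<le> sq_area n U x"
  by (rule sq_area_mono) (simp add: remainder_eq)

lemma sq_area_remainder_tendsto:
  assumes "sq_area n U x < \<infinity>"
  shows "(\<lambda>N. sq_area n (remainder N) x) \<longlonglongrightarrow> 0"
proof -
  let ?w = "\<lambda>V z. ennreal ((cmod (V z))\<^sup>2 / snd z ^ (n + 1)) * indicator (tcone n x) z"
  have [measurable]: "tcone n x \<in> sets (leb_half n)"
    by (rule sets_leb_half) (rule tcone_sets)
  have m: "?w V \<in> borel_measurable (leb_half n)" if "V \<in> borel_measurable (leb_half n)" for V
    using measurable_weight[OF that, of "n + 1"] by measurable
  have "(\<lambda>N. \<integral>\<^sup>+z. ?w (remainder N) z \<partial>leb_half n) \<longlonglongrightarrow> (\<integral>\<^sup>+z. 0 \<partial>leb_half n)"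
  proof (rule nn_integral_dominated_convergence[where w = "?w U"])
    show "AE z in leb_half n. ?w (remainder N) z \<le> ?w U z" for N
      using AE_space
    proof eventually_elim
      case (elim z)
      then have "0 < snd z"
        using dindex_bounds(2)[OF kappa(1), of z n] by (simp add: space_leb_half')
      then show ?case
        by (auto simp: remainder_eq split: split_indicator)
    qed
    show "(\<integral>\<^sup>+z. ?w U z \<partial>leb_half n) < \<infinity>"
      using assms by (simp add: sq_area_def)
    show "AE z in leb_half n. (\<lambda>N. ?w (remainder N) z) \<longlonglongrightarrow> 0"
      using AE_good
    proof eventually_elim
      case (elim z)
      \<comment> \<open>Almost every point with \<open>U z \<noteq> 0\<close> belongs to a piece, which all later remainders omit.\<close>
      have "\<forall>\<^sub>F N in sequentially. remainder N z = 0"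
        using eventually_gt_at_top[of "to_nat (stop (index z))"]
        by eventually_elim (use elim in \<open>auto simp: remainder_eq\<close>)
      then have "\<forall>\<^sub>F N in sequentially. ?w (remainder N) z = 0"
        by eventually_elim simp
      then show ?case by (rule tendsto_eventually)
    qed
    show "?w (remainder N) \<in> borel_measurable (leb_half n)" for N
      by (rule m) measurable
    show "?w U \<in> borel_measurable (leb_half n)"
      by (rule m[OF U])
  qed simp
  then show ?thesis by (simp add: sq_area_def)
qed

lemma tent_norm_remainder_tendsto: "(\<lambda>N. tent_norm n p (remainder N)) \<longlonglongrightarrow> 0"
proof -
  let ?f = "\<lambda>V x. epowr (sq_area n V x) (p / 2)"
  have m: "?f V \<in> borel_measurable (leb_Rn n)" if "V \<in> borel_measurable (leb_half n)" for V
    using measurable_sq_area[OF that] by measurable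
  have "AE x in leb_Rn n. ?f U x \<noteq> \<infinity>"
    using finite_norm by (intro nn_integral_PInf_AE m) auto
  then have fin: "AE x in leb_Rn n. sq_area n U x < \<infinity>"
    by (simp add: epowr_eq_top_iff less_top)
  have "(\<lambda>N. \<integral>\<^sup>+x. ?f (remainder N) x \<partial>leb_Rn n) \<longlonglongrightarrow> (\<integral>\<^sup>+x. 0 \<partial>leb_Rn n)"
  proof (rule nn_integral_dominated_convergence[where w = "?f U"])
    show "AE x in leb_Rn n. ?f (remainder N) x \<le> ?f U x" for N
      using p by (auto intro!: epowr_mono sq_area_remainder_le)
    show "AE x in leb_Rn n. (\<lambda>N. ?f (remainder N) x) \<longlonglongrightarrow> 0"
      using fin by eventually_elim
        (use p in \<open>auto intro!: tendsto_epowr_zero sq_area_remainder_tendsto\<close>)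
  qed (use finite_norm in \<open>auto intro: m\<close>)
  then show ?thesis
    unfolding tent_norm_eq using p by (intro tendsto_epowr_zero) auto
qed

section \<open>The balls\<close>

definition compl_dist :: "point \<Rightarrow> real" where
  "compl_dist y = (INF w\<in>Rn n - \<Omega>. edist n y w)"

definition radius :: "cube \<Rightarrow> real" where
  "radius R = min (compl_dist (corner n R) / 5) (ball_factor n \<beta> * side R)"

lemma compl_dist_le: "w \<in> Rn n \<Longrightarrow> w \<notin> \<Omega> \<Longrightarrow> compl_dist y \<le> edist n y w"
  unfolding compl_dist_def by (rule cINF_lower) (auto intro!: bdd_belowI2[of _ 0] edist_nonneg)

lemma compl_dist_greatest:
  "(\<And>w. w \<in> Rn n \<Longrightarrow> w \<notin> \<Omega> \<Longrightarrow> d \<le> edist n y w) \<Longrightarrow> d \<le> compl_dist y"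
  unfolding compl_dist_def by (rule cINF_greatest[OF compl]) auto

lemma corner_Rn: "corner n R \<in> Rn n"
  by (simp add: corner_def Rn_def)

text \<open>
  Admissibility keeps the first term of the minimum above \<open>n * side R\<close>, and \<open>n \<le> ball_factor n \<beta>\<close>
  does it for the second one.
\<close>

lemma radius_ge:
  assumes "admissible R"
  shows "n * side R \<le> radius R"
proof -
  have "5 * n * side R \<le> compl_dist (corner n R)"
  proof (rule compl_dist_greatest)
    fix w assume "w \<in> Rn n" "w \<notin> \<Omega>"
    then have "w \<notin> nball n (corner n R) (5 * n * side R)"
      using assms by (auto simp: admissible_def)
    then show "5 * n * side R \<le> edist n (corner n R) w"
      using \<open>w \<in> Rn n\<close> corner_Rn by (simp add: mem_nball)
  qed
  then show ?thesis
    using factors_pos(1)[OF n \<beta>] by (auto simp: radius_def mult_right_mono less_imp_le)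
qed

lemma radius_pos:
  assumes "admissible R"
  shows "0 < radius R"
proof -
  have "0 < n * side R" using n by simp
  then show ?thesis using radius_ge[OF assms] by linarith
qed

lemma nball_radius_subset: "nball n (corner n R) (5 * radius R) \<subseteq> \<Omega>"
proof
  fix w assume w: "w \<in> nball n (corner n R) (5 * radius R)"
  then have "w \<in> Rn n" "edist n (corner n R) w < 5 * radius R"
    by (simp_all add: mem_nball)
  moreover have "radius R \<le> compl_dist (corner n R) / 5"
    unfolding radius_def by (rule min.cobounded1)
  ultimately show "w \<in> \<Omega>"
    using compl_dist_le[of w "corner n R"] by fastforce
qed

lemma dcube_subset_nball:
  assumes "admissible R" "length (snd R) = n"
  shows "dcube n R \<subseteq> nball n (corner n R) (radius R)"
proof
  fix y assume y: "y \<in> dcube n R"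
  then have "edist n (corner n R) y < n * side R"
    using n corner_mem[OF assms(2)] by (intro edist_dcube) auto
  then show "y \<in> nball n (corner n R) (radius R)"
    using radius_ge[OF assms(1)] y corner_Rn by (simp add: mem_nball dcube_def)
qed

text \<open>
  If the radius is proportional to the side, the height of the boxes below \<open>R\<close> gives the bound.
  Otherwise the radius is a fifth of the distance of the centre from the complement, so points of
  the ball have distance less than \<open>6 * radius R\<close> from the complement, and the definition of the
  tent gives the bound.
\<close>

lemma height_less:
  assumes "admissible R" "length (snd R) = n"
    and z: "z \<in> tent n \<beta> \<Omega>" "fst z \<in> dcube n R" "snd z \<le> \<kappa> * side R"
  shows "snd z < 6 / \<beta> * radius R"
proof -
  have "\<beta> * snd z < 6 * radius R"
  proof (cases "radius R = ball_factor n \<beta> * side R")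
    case True
    have "\<beta> * snd z \<le> \<beta> * (\<kappa> * side R)"
      using z(3) \<beta> by (intro mult_left_mono) auto
    also have "\<dots> < \<beta> * (\<kappa> * side R) + 6 * (n * side R)"
      using n by simp
    also have "\<dots> = 6 * radius R"
      by (simp add: True ball_factor_def algebra_simps)
    finally show ?thesis .
  next
    case False
    then have r: "compl_dist (corner n R) = 5 * radius R"
      by (auto simp: radius_def min_def split: if_splits)
    have "\<beta> * snd z - edist n (fst z) (corner n R) \<le> compl_dist (corner n R)"
    proof (rule compl_dist_greatest)
      fix w assume "w \<in> Rn n" "w \<notin> \<Omega>"
      then show "\<beta> * snd z - edist n (fst z) (corner n R) \<le> edist n (corner n R) w"
        using tentD[OF z(1), of w] edist_triangle[of n "fst z" w "corner n R"] by linarith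
    qed
    moreover have "edist n (fst z) (corner n R) < radius R"
      using dcube_subset_nball[OF assms(1,2)] z(2) by (auto simp: mem_nball edist_commute)
    ultimately show ?thesis using r by simp
  qed
  then show ?thesis using \<beta> by (simp add: field_simps)
qed

section \<open>Atoms and coefficients\<close>

text \<open>
  The value zero for empty families makes the quotient \<open>atom\<close> zero there, and these indices add
  nothing to the sum of the coefficients.
\<close>

definition coefficient :: "nat \<Rightarrow> real" where
  "coefficient i = (if family i = {} then 0
     else atom_factor n p \<beta> * 2 powr level i * (side (top_cube i) ^ n) powr (1 / p))"

definition atom :: "nat \<Rightarrow> point \<times> real \<Rightarrow> complex" where
  "atom i z = piece i z / complex_of_real (coefficient i)"

lemma coefficient_pos:
  assumes "family i \<noteq> {}"
  shows "0 < coefficient i"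
proof -
  have "side (top_cube i) ^ n \<noteq> 0" using less_irrefl[of "0::real"] side_pos by (metis power_not_zero)
  then show ?thesis
    using factors_pos(3)[OF n \<beta>, of p] assms by (simp add: coefficient_def)
qed

lemma coefficient_atom: "complex_of_real (coefficient i) * atom i z = piece i z"
proof (cases "family i = {}")
  case True
  then show ?thesis by (simp add: atom_def piece_def)
next
  case False
  then show ?thesis using coefficient_pos[of i] by (simp add: atom_def)
qed

lemma measurable_atom [measurable]: "atom i \<in> borel_measurable (leb_half n)"
  unfolding atom_def by measurable

lemma top_cube:
  assumes "family i \<noteq> {}"
  shows "maximal (level i) (top_cube i)" "admissible (top_cube i)" "length (snd (top_cube i)) = n"
    "to_nat (level i, top_cube i) = i"
proof -
  obtain Q where "Q \<in> family i" using assms by blast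
  from family(3,6)[OF this] show "maximal (level i) (top_cube i)" "admissible (top_cube i)"
    "length (snd (top_cube i)) = n" "to_nat (level i, top_cube i) = i"
    by (simp_all add: maximal_def)
qed

lemma supp_in_atom:
  assumes "family i \<noteq> {}"
  shows "supp_in n (atom i)
    (nball n (corner n (top_cube i)) (radius (top_cube i)) \<times> {0<..<6 / \<beta> * radius (top_cube i)})"
  unfolding supp_in_def using AE_tent_of_piece[of i]
proof eventually_elim
  case (elim z)
  note t = top_cube[OF assms]
  show ?case
  proof (intro impI, rule ccontr)
    assume "z \<notin> nball n (corner n (top_cube i)) (radius (top_cube i)) \<times> {0<..<6 / \<beta> * radius (top_cube i)}"
      and "atom i z \<noteq> 0"
    moreover from this have z: "z \<in> tent n \<beta> \<Omega>" "fst z \<in> dcube n (top_cube i)"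
      "snd z \<le> \<kappa> * side (top_cube i)"
      using elim by (auto simp: atom_def)
    moreover have "0 < snd z" using z(1) by (auto simp: tent_def)
    ultimately show False
      using height_less[OF t(2,3) z] dcube_subset_nball[OF t(2,3)] by (auto simp: mem_Times_iff)
  qed
qed

lemma sum_coefficients_le:
  "(\<Sum>i. ennreal (\<bar>coefficient i\<bar> powr p))
    \<le> ennreal (decomposition_constant n p \<beta>) * (\<integral>\<^sup>+x. epowr (sq_area n U x) (p / 2) \<partial>leb_Rn n)"
proof (rule suminf_le_const)
  show "summable (\<lambda>i. ennreal (\<bar>coefficient i\<bar> powr p))" by simp
  fix N
  let ?c = "ennreal (atom_factor n p \<beta> powr p)"
  let ?N = "\<integral>\<^sup>+x. epowr (sq_area n U x) (p / 2) \<partial>leb_Rn n"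
  let ?F = "{i\<in>{..<N}. family i \<noteq> {}}"
  let ?I = "(\<lambda>i. (level i, top_cube i)) ` ?F"
  have inj: "inj_on (\<lambda>i. (level i, top_cube i)) ?F"
    using top_cube(4) by (intro inj_onI) (metis (mono_tags, lifting) mem_Collect_eq)
  have c: "ennreal (\<bar>coefficient i\<bar> powr p)
      = ?c * (ennreal (2 powr (level i * p)) * emeasure (leb_Rn n) (dcube n (top_cube i)))"
    if "family i \<noteq> {}" for i
  proof -
    have "\<bar>coefficient i\<bar> powr p
        = atom_factor n p \<beta> powr p * (2 powr (level i * p) * side (top_cube i) ^ n)"
      using that p factors_pos(3)[OF n \<beta>, of p]
      by (simp add: coefficient_def powr_mult powr_powr less_imp_le)
    then show ?thesis
      by (simp add: emeasure_dcube[OF top_cube(3)[OF that]] ennreal_mult less_imp_le)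
  qed
  have "(\<Sum>i<N. ennreal (\<bar>coefficient i\<bar> powr p)) = (\<Sum>i\<in>?F. ennreal (\<bar>coefficient i\<bar> powr p))"
    by (rule sum.mono_neutral_right) (auto simp: coefficient_def)
  also have "\<dots> = ?c * (\<Sum>i\<in>?F. ennreal (2 powr (level i * p)) * emeasure (leb_Rn n) (dcube n (top_cube i)))"
    unfolding sum_distrib_left using c by (intro sum.cong) auto
  also have "\<dots> = ?c * (\<Sum>(k, R)\<in>?I. ennreal (2 powr (real_of_int k * p)) * emeasure (leb_Rn n) (dcube n R))"
    by (subst sum.reindex[OF inj]) (simp add: o_def)
  also have "\<dots> \<le> ?c * (ennreal (2 / (1 - 2 powr (- p))) * ?N)"
  proof (intro mult_left_mono sum_maximal_le)
    fix k R assume "(k, R) \<in> ?I"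
    then show "maximal k R" using top_cube(1) by blast
  qed auto
  also have "\<dots> = ennreal (decomposition_constant n p \<beta>) * ?N"
  proof -
    have "0 \<le> 2 / (1 - 2 powr (- p))" using p powr_less_mono[of "- p" 0 2] by simp
    then have "ennreal (decomposition_constant n p \<beta>) = ?c * ennreal (2 / (1 - 2 powr (- p)))"
      unfolding decomposition_constant_def by (intro ennreal_mult) auto
    then show ?thesis by (simp only: mult.assoc)
  qed
  finally show "(\<Sum>i<N. ennreal (\<bar>coefficient i\<bar> powr p)) \<le> ennreal (decomposition_constant n p \<beta>) * ?N" .
qed

text \<open>
  This identity is the reason for the choice of \<open>atom_factor\<close>.
\<close>

lemma coefficient_sq:
  assumes "family i \<noteq> {}"
  shows "8 * \<kappa> ^ n * 4 powr level i * side (top_cube i) ^ n / (coefficient i)\<^sup>2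
    = (volume_ratio n \<beta> * side (top_cube i) ^ n) powr (1 - 2 / p)"
proof -
  let ?v = "side (top_cube i) ^ n" and ?C = "volume_ratio n \<beta>"
  let ?a = "8 * \<kappa> ^ n * 4 powr level i"
  have pos: "0 < ?v" "0 < ?C" "0 < ?a" using factors_pos[OF n \<beta>] kappa(1) by auto
  have split: "t powr a * t powr (1 - a) = t" if "0 < t" for t a :: real
    using that by (simp flip: powr_add)
  have sq: "(t powr s)\<^sup>2 = t powr (2 * s)" for t s :: real
    by (simp add: power2_eq_square flip: powr_add)
  have four: "(4::real) powr level i = 2 powr (2 * level i)"
    using powr_powr[of "2::real" 2 "level i"] by simp
  have "(coefficient i)\<^sup>2 = ?a * (?C powr (2 / p - 1) * ?v powr (2 / p))"
    using assms kappa(1)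
    by (simp add: coefficient_def atom_factor_def power_mult_distrib sq four algebra_simps less_imp_le)
  moreover have "?C powr (2 / p - 1) * ?C powr (1 - 2 / p) = 1"
    using pos(2) by (simp flip: powr_add)
  moreover have "?v powr (2 / p) * ?v powr (1 - 2 / p) = ?v"
    using pos(1) by (rule split)
  ultimately have "(coefficient i)\<^sup>2 * (?C * ?v) powr (1 - 2 / p) = ?a * ?v"
    using pos by (simp add: powr_mult algebra_simps less_imp_le)
  then show ?thesis
    using coefficient_pos[OF assms] by (simp add: field_simps)
qed

text \<open>
  The size condition combines \<open>piece_energy\<close> with \<open>coefficient_sq\<close>: the exponent \<open>1 - 2 / p\<close> is
  negative, so the upper bound for the volume of the ball is a lower bound for the power of it.
\<close>

lemma tent_atom_atom:
  assumes i: "family i \<noteq> {}"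
  shows "tent_atom n p (corner n (top_cube i)) (radius (top_cube i) / inner_ratio \<beta>) (atom i)"
proof -
  let ?R = "top_cube i"
  let ?x = "corner n ?R" and ?\<rho> = "radius ?R" and ?c = "inner_ratio \<beta>"
  let ?r = "?\<rho> / ?c"
  let ?m = "measure (leb_Rn n) (nball n ?x ?r)"
  note t = top_cube[OF i]
  note c = inner_ratio[OF \<beta>]
  have \<rho>: "0 < ?\<rho>" by (rule radius_pos[OF t(2)])
  have r: "?\<rho> = ?c * ?r" "?\<rho> \<le> ?r" "0 < ?r" using c \<rho> by (auto simp: field_simps)
  have sub: "nball n ?x ?\<rho> \<times> {0<..<6 / \<beta> * ?\<rho>} \<subseteq> tent n 1 (nball n ?x ?r)"
  proof
    fix z assume z: "z \<in> nball n ?x ?\<rho> \<times> {0<..<6 / \<beta> * ?\<rho>}"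
    have "snd z \<le> edist n (fst z) w" if w: "w \<in> Rn n - nball n ?x ?r" for w
    proof -
      have "snd z < 6 / \<beta> * ?\<rho>" using z by auto
      also have "\<dots> = (6 / \<beta> * ?c) * ?r" using c(1) by simp
      also have "\<dots> = ?r - ?\<rho>" unfolding c(3) using c(1) by (simp add: field_simps)
      finally have "snd z \<le> ?r - ?\<rho>" by simp
      moreover have "edist n ?x (fst z) < ?\<rho>" using z by (auto simp: mem_nball)
      moreover have "?r \<le> edist n ?x w" using w corner_Rn by (auto simp: mem_nball)
      ultimately show ?thesis using edist_triangle[of n ?x w "fst z"] by linarith
    qed
    then show "z \<in> tent n 1 (nball n ?x ?r)"
      using z unfolding tent_def by (auto simp: mem_nball intro!: INF_greatest)
  qed
  have "?\<rho> / ?c \<le> ball_factor n \<beta> * side ?R / ?c"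
    using c(1) by (intro divide_right_mono) (auto simp: radius_def)
  then have "(2 * ?r) ^ n \<le> (2 * (ball_factor n \<beta> * side ?R / ?c)) ^ n"
    using r(3) by (intro power_mono) auto
  also have "\<dots> = volume_ratio n \<beta> * side ?R ^ n"
    by (simp add: volume_ratio_def power_mult_distrib power_divide)
  finally have le: "(2 * ?r) ^ n \<le> volume_ratio n \<beta> * side ?R ^ n" .
  have ball: "emeasure (leb_Rn n) (nball n ?x ?r) \<le> ennreal ((2 * ?r) ^ n)"
    using r(3) by (intro emeasure_nball_le) auto
  then have em: "emeasure (leb_Rn n) (nball n ?x ?r) = ennreal ?m"
    by (intro emeasure_eq_ennreal_measure) (auto simp: top_unique)
  have "?m \<le> volume_ratio n \<beta> * side ?R ^ n"
    using ball le r(3) unfolding em by (simp add: ennreal_le_iff)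
  \<comment> \<open>The power has a negative exponent, and \<open>0 powr a = 0\<close>, so the volume must be positive.\<close>
  moreover have "0 < ?m"
  proof -
    have "dcube n ?R \<subseteq> nball n ?x ?r"
      using dcube_subset_nball[OF t(2,3)] r(2) by (force simp: mem_nball)
    then have "emeasure (leb_Rn n) (dcube n ?R) \<le> emeasure (leb_Rn n) (nball n ?x ?r)"
      by (intro emeasure_mono sets_leb_Rn nball_sets)
    then have "side ?R ^ n \<le> ?m"
      unfolding em emeasure_dcube[OF t(3)] by (simp add: ennreal_le_iff)
    moreover have "0 < side ?R ^ n" by simp
    ultimately show ?thesis by linarith
  qed
  moreover have "1 - 2 / p \<le> 0" using p by (simp add: field_simps)
  ultimately have m: "(volume_ratio n \<beta> * side ?R ^ n) powr (1 - 2 / p) \<le> ?m powr (1 - 2 / p)"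
    by (intro powr_mono2') auto
  have "(\<integral>\<^sup>+z. ennreal ((cmod (atom i z))\<^sup>2 / snd z) \<partial>leb_half n)
      = (\<integral>\<^sup>+z. ennreal (1 / (coefficient i)\<^sup>2) * ennreal ((cmod (piece i z))\<^sup>2 / snd z) \<partial>leb_half n)"
    by (intro nn_integral_cong)
       (simp add: atom_def norm_divide power_divide mult.commute flip: ennreal_mult')
  also have "\<dots> = ennreal (1 / (coefficient i)\<^sup>2) * (\<integral>\<^sup>+z. ennreal ((cmod (piece i z))\<^sup>2 / snd z) \<partial>leb_half n)"
    using measurable_weight[OF measurable_piece, of i 1] by (intro nn_integral_cmult) simp
  also have "\<dots> \<le> ennreal (1 / (coefficient i)\<^sup>2) * ennreal (8 * \<kappa> ^ n * 4 powr level i * side ?R ^ n)"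
    using i piece_energy by (intro mult_left_mono) auto
  also have "\<dots> = ennreal (8 * \<kappa> ^ n * 4 powr level i * side ?R ^ n / (coefficient i)\<^sup>2)"
    by (simp flip: ennreal_mult')
  also have "\<dots> \<le> ennreal (?m powr (1 - 2 / p))"
    unfolding coefficient_sq[OF i] by (rule ennreal_leI[OF m])
  finally have "(\<integral>\<^sup>+z. ennreal ((cmod (atom i z))\<^sup>2 / snd z) \<partial>leb_half n) \<le> ennreal (?m powr (1 - 2 / p))" .
  moreover have "supp_in n (atom i) (tent n 1 (nball n ?x ?r))"
    using supp_in_atom[OF i] sub unfolding supp_in_def by (auto elim!: eventually_mono)
  ultimately show ?thesis
    using corner_Rn r(3) by (simp add: tent_atom_def)
qed

end

lemma tent_atom_zero:
  assumes "x \<in> Rn n" "0 < r"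
  shows "tent_atom n p x r (\<lambda>_. 0)"
  using assms by (simp add: tent_atom_def supp_in_def)

theorem theorem6p11:
  fixes \<beta> :: real
  assumes "0 < \<beta>"
  shows "\<exists>c::real. 0 < c \<and> c < 1 \<and>
    (\<forall>(n::nat) (p::real). 1 \<le> n \<and> 0 < p \<and> p \<le> 1 \<longrightarrow>
      (\<exists>C::real. 0 < C \<and>
        (\<forall>(U :: point \<times> real \<Rightarrow> complex) (\<Omega> :: point set).
          U \<in> tent_space n p \<and> nopen n \<Omega> \<and> \<Omega> \<noteq> {} \<and> \<Omega> \<noteq> Rn n \<and> supp_in n U (tent n \<beta> \<Omega>) \<longrightarrow>
          (\<exists>(lam :: nat \<Rightarrow> complex) (A :: nat \<Rightarrow> point \<times> real \<Rightarrow> complex)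
             (x :: nat \<Rightarrow> point) (r :: nat \<Rightarrow> real).
             summable (\<lambda>k. cmod (lam k) powr p) \<and>
             (\<forall>k. tent_atom n p (x k) (r k) (A k)) \<and>
             (\<lambda>N. tent_norm n p (\<lambda>z. U z - (\<Sum>k<N. lam k * A k z))) \<longlonglongrightarrow> 0 \<and>
             (\<Sum>k. ennreal (cmod (lam k) powr p)) \<le> ennreal C * epowr (tent_norm n p U) p \<and>
             (\<forall>k. supp_in n (A k) (nball n (x k) (c * r k) \<times> {0<..<6 / \<beta> * c * r k}) \<and>
                  nball n (x k) (5 * c * r k) \<subseteq> \<Omega>)))))"
proof (rule exI[of _ "inner_ratio \<beta>"], intro conjI allI impI)
  show "0 < inner_ratio \<beta>" "inner_ratio \<beta> < 1" using inner_ratio[OF assms] by auto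
next
  fix n :: nat and p :: real
  assume np: "1 \<le> n \<and> 0 < p \<and> p \<le> 1"
  let ?c = "inner_ratio \<beta>" and ?C = "decomposition_constant n p \<beta>"
  note c = inner_ratio[OF assms]
  show "\<exists>C::real. 0 < C \<and>
        (\<forall>(U :: point \<times> real \<Rightarrow> complex) (\<Omega> :: point set).
          U \<in> tent_space n p \<and> nopen n \<Omega> \<and> \<Omega> \<noteq> {} \<and> \<Omega> \<noteq> Rn n \<and> supp_in n U (tent n \<beta> \<Omega>) \<longrightarrow>
          (\<exists>(lam :: nat \<Rightarrow> complex) (A :: nat \<Rightarrow> point \<times> real \<Rightarrow> complex)
             (x :: nat \<Rightarrow> point) (r :: nat \<Rightarrow> real).
             summable (\<lambda>k. cmod (lam k) powr p) \<and>
             (\<forall>k. tent_atom n p (x k) (r k) (A k)) \<and>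
             (\<lambda>N. tent_norm n p (\<lambda>z. U z - (\<Sum>k<N. lam k * A k z))) \<longlonglongrightarrow> 0 \<and>
             (\<Sum>k. ennreal (cmod (lam k) powr p)) \<le> ennreal C * epowr (tent_norm n p U) p \<and>
             (\<forall>k. supp_in n (A k) (nball n (x k) (?c * r k) \<times> {0<..<6 / \<beta> * ?c * r k}) \<and>
                  nball n (x k) (5 * ?c * r k) \<subseteq> \<Omega>)))"
  proof (rule exI[of _ ?C], intro conjI allI impI)
    show "0 < ?C" using np assms by (intro decomposition_constant_pos) auto
  next
    fix U :: "point \<times> real \<Rightarrow> complex" and \<Omega> :: "point set"
    assume asm: "U \<in> tent_space n p \<and> nopen n \<Omega> \<and> \<Omega> \<noteq> {} \<and> \<Omega> \<noteq> Rn n \<and> supp_in n U (tent n \<beta> \<Omega>)"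
    let ?N = "\<integral>\<^sup>+x. epowr (sq_area n U x) (p / 2) \<partial>leb_Rn n"
    have norm: "epowr (tent_norm n p U) p = ?N"
      using np by (simp add: tent_norm_eq epowr_epowr)
    have fin: "?N < \<infinity>"
    proof -
      have "epowr ?N (1 / p) \<noteq> top"
        using asm by (auto simp: tent_space_def tent_norm_eq)
      then show ?thesis by (simp add: epowr_eq_top_iff less_top)
    qed
    have open_\<Omega>: "\<Omega> \<subseteq> Rn n" "\<forall>x\<in>\<Omega>. \<exists>r>0. nball n x r \<subseteq> \<Omega>"
      using asm by (auto simp: Metric_space.openin_mtopology[OF Metric_space_Rn])
    interpret tent_decomposition n p \<beta> U \<Omega>
      using np assms asm fin open_\<Omega> by unfold_locales (auto simp: tent_space_def)
    \<comment> \<open>Indices with empty families carry the zero atom over a fixed ball inside \<open>\<Omega>\<close>.\<close>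
    obtain x0 r0 where x0: "x0 \<in> \<Omega>" "0 < r0" "nball n x0 r0 \<subseteq> \<Omega>"
      using asm open_\<Omega>(2) by blast
    define x where "x i = (if family i = {} then x0 else corner n (top_cube i))" for i
    define r where "r i = (if family i = {} then r0 / 5 else radius (top_cube i)) / ?c" for i
    let ?lam = "\<lambda>i. complex_of_real (coefficient i)"
    have zero: "atom i = (\<lambda>_. 0)" if "family i = {}" for i
      using that by (auto simp: atom_def piece_def)
    have sum: "(\<Sum>i. ennreal (cmod (?lam i) powr p)) \<le> ennreal ?C * ?N"
      using sum_coefficients_le by simp
    have "summable (\<lambda>i. cmod (?lam i) powr p)"
    proof (rule summable_suminf_not_top)
      have "ennreal ?C * ?N < top" using fin by (simp add: ennreal_mult_less_top)
      then show "(\<Sum>i. ennreal (cmod (?lam i) powr p)) \<noteq> top"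
        using sum by auto
    qed simp
    moreover have "\<forall>i. tent_atom n p (x i) (r i) (atom i)"
      using tent_atom_atom tent_atom_zero[of x0 n "r0 / 5 / ?c" p] x0 open_\<Omega>(1) c(1)
      by (auto simp: x_def r_def zero)
    moreover have "(\<lambda>N. tent_norm n p (\<lambda>z. U z - (\<Sum>i<N. ?lam i * atom i z))) \<longlonglongrightarrow> 0"
      using tent_norm_remainder_tendsto by (simp add: coefficient_atom remainder_def[abs_def])
    moreover have "\<forall>i. supp_in n (atom i) (nball n (x i) (?c * r i) \<times> {0<..<6 / \<beta> * ?c * r i}) \<and>
        nball n (x i) (5 * ?c * r i) \<subseteq> \<Omega>"
    proof (rule allI)
      fix i
      show "supp_in n (atom i) (nball n (x i) (?c * r i) \<times> {0<..<6 / \<beta> * ?c * r i}) \<and>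
        nball n (x i) (5 * ?c * r i) \<subseteq> \<Omega>"
      proof (cases "family i = {}")
        case True
        then show ?thesis
          using x0(3) c(1) by (simp add: x_def r_def zero supp_in_def)
      next
        case False
        then show ?thesis
          using supp_in_atom[OF False] nball_radius_subset[of "top_cube i"] c(1)
          by (simp add: x_def r_def)
      qed
    qed
    ultimately show "\<exists>lam A x r. summable (\<lambda>k. cmod (lam k) powr p) \<and>
             (\<forall>k. tent_atom n p (x k) (r k) (A k)) \<and>
             (\<lambda>N. tent_norm n p (\<lambda>z. U z - (\<Sum>k<N. lam k * A k z))) \<longlonglongrightarrow> 0 \<and>
             (\<Sum>k. ennreal (cmod (lam k) powr p)) \<le> ennreal ?C * epowr (tent_norm n p U) p \<and>
             (\<forall>k. supp_in n (A k) (nball n (x k) (?c * r k) \<times> {0<..<6 / \<beta> * ?c * r k}) \<and>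
                  nball n (x k) (5 * ?c * r k) \<subseteq> \<Omega>)"
      unfolding norm using sum
      by (intro exI[of _ ?lam] exI[of _ atom] exI[of _ x] exI[of _ r] conjI)
  qed
qed

end
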